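(* Let $(G,c)$ be an infinite network satisfying the standing assumptions. For all $x,y\in G$, the wired effective resistance is $$R^W(x,y)=\int_0^\infty\frac1\lambda\,\bigl\|P_2(d\lambda)(\delta_x-\delta_y)\bigr\|_2^2 ,$$ where $P_2$ is the projection-valued spectral measure of $\Delta_2$ on $\ell^2(G)$.
   Context: A network $(G,c)$ is a connected undirected graph $G$ (we write $x\in G$ for vertices) with a symmetric conductance function $c:G\times G\to[0,\infty)$, where $x,y$ are neighbours, $x\sim y$, iff $c_{xy}>0$. Every vertex has finitely many neighbours. Fix a reference vertex $o\in G$. The Laplacian acts on $u:G\to\mathbb R$ by $(\Delta u)(x)=\sum_{y\sim x}c_{xy}(u(x)-u(y))$. The energy form is $\mathcal E(u,v)=\frac12\sum_{x,y\in G}c_{xy}(u(x)-u(y))(v(x)-v(y))$ on $\operatorname{dom}\mathcal E=\{u:G\to\mathbb R:\mathcal E(u,u)<\infty\}$, and $\mathcal E(u)=\mathcal E(u,u)$. The energy space $\mathcal H_{\mathcal E}=\operatorname{dom}\mathcal E/\mathbb R\mathbf 1$ (functions modulo constants) is a Hilbert space with inner product $\langle u,v\rangle_{\mathcal E}=\mathcal E(u,v)$. For $x\in G$, $v_x\in\mathcal H_{\mathcal E}$ is the unique element with $\langle v_x,u\rangle_{\mathcal E}=u(x)-u(o)$ for all $u\in\mathcal H_{\mathcal E}$. Let $\delta_x$ be the characteristic function of $\{x\}$. $\mathrm{Fin}$ is the closure in $\mathcal H_{\mathcal E}$ of $\operatorname{span}\{\delta_x\}_{x\in G}$, $P_{\mathrm{Fin}}$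 is the orthogonal projection of $\mathcal H_{\mathcal E}$ onto it, and $f_x:=P_{\mathrm{Fin}}v_x$. The wired effective resistance is $R^W(x,y):=\mathcal E(f_x-f_y)$. Standing assumption: the network is transient, i.e. for some (equivalently every) $x$ there is $w\in\mathcal H_{\mathcal E}$ with $\Delta w=\delta_x$. $\ell^2(G)$ carries $\langle u,v\rangle_2=\sum_x u(x)v(x)$, and $\Delta_2$ is the closure in $\ell^2(G)$ of $\Delta$ on $\operatorname{span}\{\delta_x\}_{x\in G}$; it is known to be self-adjoint and non-negative. The notation $\|P_2(d\lambda)\xi\|_2^2$ denotes integration against the measure $A\mapsto\|P_2(A)\xi\|_2^2$. For an infinite network $0$ is not an eigenvalue of $\Delta_2$. *)

theory Defs
  imports "HOL-Analysis.Analysis"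
begin

lemma square_summable_mult:
  fixes f g :: "'a \<Rightarrow> real"
  assumes "(\<lambda>x. (f x)\<^sup>2) summable_on A" and "(\<lambda>x. (g x)\<^sup>2) summable_on A"
  shows "(\<lambda>x. f x * g x) summable_on A"
proof -
  have "norm (f x * g x) \<le> (f x)\<^sup>2 + (g x)\<^sup>2" for x
  proof -
    have "0 \<le> (\<bar>f x\<bar> - \<bar>g x\<bar>)\<^sup>2" by simp
    hence "2 * (\<bar>f x\<bar> * \<bar>g x\<bar>) \<le> (f x)\<^sup>2 + (g x)\<^sup>2"
      by (simp add: power2_diff)
    moreover have "0 \<le> \<bar>f x\<bar> * \<bar>g x\<bar>" by simp
    ultimately show ?thesis unfolding real_norm_def abs_mult by linarith
  qed
  hence "(\<lambda>x. norm (f x * g x)) summable_on A"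
    by (intro Infinite_Sum.abs_summable_on_comparison_test'[OF summable_on_add[OF assms]])
  thus ?thesis by (rule abs_summable_summable)
qed

lemma square_summable_add:
  fixes f g :: "'a \<Rightarrow> real"
  assumes "(\<lambda>x. (f x)\<^sup>2) summable_on A" and "(\<lambda>x. (g x)\<^sup>2) summable_on A"
  shows "(\<lambda>x. (f x + g x)\<^sup>2) summable_on A"
proof -
  have "(\<lambda>x. ((f x)\<^sup>2 + (g x)\<^sup>2) + 2 * (f x * g x)) summable_on A"
    by (intro summable_on_add summable_on_cmult_right assms square_summable_mult)
  moreover have "((f x)\<^sup>2 + (g x)\<^sup>2) + 2 * (f x * g x) = (f x + g x)\<^sup>2" for x
    by (simp add: power2_sum)
  ultimately show ?thesis by (simp only:)
qed

lemma square_summable_scale: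
  fixes f :: "'a \<Rightarrow> real"
  assumes "(\<lambda>x. (f x)\<^sup>2) summable_on A"
  shows "(\<lambda>x. (r * f x)\<^sup>2) summable_on A"
  using summable_on_cmult_right[OF assms, of "r\<^sup>2"] by (simp add: power_mult_distrib)

typedef 'a ell2 = "{f :: 'a \<Rightarrow> real. (\<lambda>x. (f x)\<^sup>2) summable_on UNIV}"
  morphisms fun_of Abs_ell2
  by (rule exI[of _ "\<lambda>_. 0"]) simp

setup_lifting type_definition_ell2

instantiation ell2 :: (type) real_inner
begin

lift_definition zero_ell2 :: "'a ell2" is "\<lambda>_. 0" by simp

lift_definition plus_ell2 :: "'a ell2 \<Rightarrow> 'a ell2 \<Rightarrow> 'a ell2" is "\<lambda>f g x. f x + g x"
  by (rule square_summable_add)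

lift_definition uminus_ell2 :: "'a ell2 \<Rightarrow> 'a ell2" is "\<lambda>f x. - f x" by simp

lift_definition minus_ell2 :: "'a ell2 \<Rightarrow> 'a ell2 \<Rightarrow> 'a ell2" is "\<lambda>f g x. f x - g x"
proof -
  fix f g :: "'a \<Rightarrow> real"
  assume "(\<lambda>x. (f x)\<^sup>2) summable_on UNIV" "(\<lambda>x. (g x)\<^sup>2) summable_on UNIV"
  hence "(\<lambda>x. (f x + (- g x))\<^sup>2) summable_on UNIV"
    by (intro square_summable_add) auto
  thus "(\<lambda>x. (f x - g x)\<^sup>2) summable_on UNIV" by simp
qed

lift_definition scaleR_ell2 :: "real \<Rightarrow> 'a ell2 \<Rightarrow> 'a ell2" is "\<lambda>r f x. r * f x"
  by (rule square_summable_scale)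

lift_definition inner_ell2 :: "'a ell2 \<Rightarrow> 'a ell2 \<Rightarrow> real" is "\<lambda>f g. \<Sum>\<^sub>\<infinity>x. f x * g x" .

definition norm_ell2 :: "'a ell2 \<Rightarrow> real" where "norm_ell2 u = sqrt (inner u u)"

definition sgn_ell2 :: "'a ell2 \<Rightarrow> 'a ell2" where "sgn_ell2 u = scaleR (inverse (norm u)) u"

definition dist_ell2 :: "'a ell2 \<Rightarrow> 'a ell2 \<Rightarrow> real" where "dist_ell2 u v = norm (u - v)"

definition uniformity_ell2 :: "('a ell2 \<times> 'a ell2) filter"
  where "uniformity_ell2 = (INF e\<in>{0 <..}. principal {(x, y). dist x y < e})"

definition open_ell2 :: "'a ell2 set \<Rightarrow> bool"
  where "open_ell2 S = (\<forall>x\<in>S. \<forall>\<^sub>F (x', y) in uniformity. x' = x \<longrightarrow> y \<in> S)"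

instance
proof
  fix u v w :: "'a ell2" and r s :: real
  show "r *\<^sub>R (u + v) = r *\<^sub>R u + r *\<^sub>R v" by transfer (simp add: distrib_left)
  show "(r + s) *\<^sub>R u = r *\<^sub>R u + s *\<^sub>R u" by transfer (simp add: distrib_right)
  show "r *\<^sub>R s *\<^sub>R u = (r * s) *\<^sub>R u" by transfer (simp add: mult.assoc)
  show "1 *\<^sub>R u = u" by transfer simp
  show "u + v + w = u + (v + w)" by transfer (simp add: add.assoc)
  show "u + v = v + u" by transfer (simp add: add.commute)
  show "0 + u = u" by transfer simp
  show "- u + u = 0" by transfer simp
  show "u - v = u + - v" by transfer simp
  show "sgn u = inverse (norm u) *\<^sub>R u" by (rule sgn_ell2_def)
  show "dist u v = norm (u - v)" by (rule dist_ell2_def)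
  show "uniformity = (INF e\<in>{0<..}. principal {(x, y::'a ell2). dist x y < e})"
    by (rule uniformity_ell2_def)
  show "open S = (\<forall>x\<in>S. \<forall>\<^sub>F (x', y) in uniformity. x' = x \<longrightarrow> y \<in> S)" for S :: "'a ell2 set"
    by (rule open_ell2_def)
  show "inner u v = inner v u" by transfer (simp add: mult.commute)
  show "inner (u + v) w = inner u w + inner v w"
  proof transfer
    fix f g h :: "'a \<Rightarrow> real"
    assume "(\<lambda>x. (f x)\<^sup>2) summable_on UNIV" "(\<lambda>x. (g x)\<^sup>2) summable_on UNIV"
      and "(\<lambda>x. (h x)\<^sup>2) summable_on UNIV"
    from infsum_add[OF square_summable_mult[OF this(1,3)] square_summable_mult[OF this(2,3)]]
    show "(\<Sum>\<^sub>\<infinity>x. (f x + g x) * h x) = (\<Sum>\<^sub>\<infinity>x. f x * h x) + (\<Sum>\<^sub>\<infinity>x. g x * h x)"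
      by (simp only: distrib_right)
  qed
  show "inner (r *\<^sub>R u) v = r * inner u v"
    by transfer (simp add: mult.assoc infsum_cmult_right')
  show "0 \<le> inner u u" by transfer (simp add: infsum_nonneg)
  show "inner u u = 0 \<longleftrightarrow> u = 0"
  proof transfer
    fix f :: "'a \<Rightarrow> real"
    assume f: "(\<lambda>x. (f x)\<^sup>2) summable_on UNIV"
    show "((\<Sum>\<^sub>\<infinity>x. f x * f x) = 0) = (f = (\<lambda>_. 0))"
    proof
      assume *: "(\<Sum>\<^sub>\<infinity>x. f x * f x) = 0"
      have "f x * f x = 0" for x
        by (rule nonneg_infsum_le_0D[where A = UNIV and f = "\<lambda>x. f x * f x"])
          (simp_all add: * f[unfolded power2_eq_square])
      thus "f = (\<lambda>_. 0)" by auto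
    qed simp
  qed
  show "norm u = sqrt (inner u u)" by (rule norm_ell2_def)
qed

end

lemma fun_of_summable: "(\<lambda>x. (fun_of u x)\<^sup>2) summable_on UNIV"
  using fun_of[of u] by simp

lemma fun_of_diff: "fun_of (u - v) x = fun_of u x - fun_of v x"
  by (simp add: minus_ell2.rep_eq)

lemma norm_ell2_sq: "(norm u)\<^sup>2 = (\<Sum>\<^sub>\<infinity>x. (fun_of u x)\<^sup>2)"
  unfolding power2_norm_eq_inner inner_ell2.rep_eq by (simp add: power2_eq_square)

lemma finite_sum_le_norm_ell2:
  "finite F \<Longrightarrow> (\<Sum>x\<in>F. (fun_of u x)\<^sup>2) \<le> (norm u)\<^sup>2"
  unfolding norm_ell2_sq by (rule finite_sum_le_infsum[OF fun_of_summable]) auto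

lemma fun_of_le_norm: "\<bar>fun_of u x\<bar> \<le> norm u"
  using finite_sum_le_norm_ell2[of "{x}" u] by (simp add: abs_le_square_iff[symmetric])

instance ell2 :: (type) complete_space
proof
  fix X :: "nat \<Rightarrow> 'a ell2"
  assume X: "Cauchy X"
  define L where "L i = lim (\<lambda>n. fun_of (X n) i)" for i
  have "Cauchy (\<lambda>n. fun_of (X n) i)" for i
  proof (rule metric_CauchyI)
    fix e :: real assume "0 < e"
    then obtain M where M: "\<And>m n. m \<ge> M \<Longrightarrow> n \<ge> M \<Longrightarrow> dist (X m) (X n) < e"
      using metric_CauchyD[OF X] by blast
    have "dist (fun_of (X m) i) (fun_of (X n) i) \<le> dist (X m) (X n)" for m n
      using fun_of_le_norm[of "X m - X n" i] by (simp add: dist_norm fun_of_diff)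
    hence "dist (fun_of (X m) i) (fun_of (X n) i) < e" if "m \<ge> M" "n \<ge> M" for m n
      using M[OF that] by (rule le_less_trans)
    thus "\<exists>M. \<forall>m\<ge>M. \<forall>n\<ge>M. dist (fun_of (X m) i) (fun_of (X n) i) < e"
      by blast
  qed
  hence L: "(\<lambda>n. fun_of (X n) i) \<longlonglongrightarrow> L i" for i
    unfolding L_def by (intro iffD1[OF convergent_LIMSEQ_iff] Cauchy_convergent)
  have bound: "\<exists>M. \<forall>n\<ge>M. \<forall>F. finite F \<longrightarrow> (\<Sum>i\<in>F. (fun_of (X n) i - L i)\<^sup>2) \<le> e\<^sup>2"
    if e: "0 < e" for e :: real
  proof -
    obtain M where M: "\<And>m n. m \<ge> M \<Longrightarrow> n \<ge> M \<Longrightarrow> dist (X m) (X n) < e"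
      using metric_CauchyD[OF X e] by blast
    have "(\<Sum>i\<in>F. (fun_of (X n) i - L i)\<^sup>2) \<le> e\<^sup>2" if "n \<ge> M" "finite F" for n F
    proof (rule LIMSEQ_le_const2)
      show "(\<lambda>m. \<Sum>i\<in>F. (fun_of (X n) i - fun_of (X m) i)\<^sup>2)
          \<longlonglongrightarrow> (\<Sum>i\<in>F. (fun_of (X n) i - L i)\<^sup>2)"
        by (intro tendsto_intros L)
      show "\<exists>N. \<forall>m\<ge>N. (\<Sum>i\<in>F. (fun_of (X n) i - fun_of (X m) i)\<^sup>2) \<le> e\<^sup>2"
      proof (intro exI allI impI)
        fix m assume "m \<ge> M"
        have "(\<Sum>i\<in>F. (fun_of (X n) i - fun_of (X m) i)\<^sup>2) \<le> (norm (X n - X m))\<^sup>2"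
          using finite_sum_le_norm_ell2[OF \<open>finite F\<close>, of "X n - X m"] by (simp add: fun_of_diff)
        also have "\<dots> \<le> e\<^sup>2"
          using M[OF \<open>n \<ge> M\<close> \<open>m \<ge> M\<close>] by (intro power_mono) (auto simp: dist_norm)
        finally show "(\<Sum>i\<in>F. (fun_of (X n) i - fun_of (X m) i)\<^sup>2) \<le> e\<^sup>2" .
      qed
    qed
    thus ?thesis by blast
  qed
  have diff: "(\<lambda>i. (fun_of (X n) i - L i)\<^sup>2) summable_on UNIV"
    if "\<forall>F. finite F \<longrightarrow> (\<Sum>i\<in>F. (fun_of (X n) i - L i)\<^sup>2) \<le> e\<^sup>2" for n and e :: real
    using that by (intro nonneg_bdd_above_summable_on bdd_aboveI2[where M = "e\<^sup>2"]) auto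
  obtain M where "\<forall>F. finite F \<longrightarrow> (\<Sum>i\<in>F. (fun_of (X M) i - L i)\<^sup>2) \<le> 1\<^sup>2"
    using bound[of 1] by auto
  from diff[OF this] have "(\<lambda>i. (L i - fun_of (X M) i)\<^sup>2) summable_on UNIV"
    by (simp add: power2_commute)
  from square_summable_add[OF fun_of_summable[of "X M"] this]
  have Lmem: "(\<lambda>i. (L i)\<^sup>2) summable_on UNIV" by simp
  define l where "l = Abs_ell2 L"
  have l: "fun_of l = L" unfolding l_def using Lmem by (simp add: Abs_ell2_inverse)
  have "X \<longlonglongrightarrow> l"
  proof (rule metric_LIMSEQ_I)
    fix r :: real assume r: "0 < r"
    obtain M where M: "\<forall>n\<ge>M. \<forall>F. finite F \<longrightarrow> (\<Sum>i\<in>F. (fun_of (X n) i - L i)\<^sup>2) \<le> (r/2)\<^sup>2"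
      using bound[of "r/2"] r by auto
    have "dist (X n) l < r" if "n \<ge> M" for n
    proof -
      have "(norm (X n - l))\<^sup>2 \<le> (r/2)\<^sup>2"
        unfolding norm_ell2_sq fun_of_diff l
        using M that by (intro infsum_le_finite_sums diff[where e = "r/2"]) auto
      hence "norm (X n - l) \<le> r/2" using r by (simp add: power2_le_iff_abs_le)
      thus ?thesis using r by (simp add: dist_norm)
    qed
    thus "\<exists>no. \<forall>n\<ge>no. dist (X n) l < r" by blast
  qed
  thus "convergent X" by (auto simp: convergent_def)
qed

lift_definition delta2 :: "'a \<Rightarrow> 'a ell2" is "\<lambda>x. indicator {x}"
  by (rule finite_nonzero_values_imp_summable_on) (auto simp: indicator_def)


text \<open>
  The energy space is a subset of this quotient. The quotient itself does not depend on
  the conductances, so it can be a type.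
\<close>

quotient_type 'a modconst = "'a \<Rightarrow> real" / "\<lambda>u v. \<exists>k. \<forall>x. u x - v x = k"
proof (rule equivpI)
  show "reflp (\<lambda>u v :: 'a \<Rightarrow> real. \<exists>k. \<forall>x. u x - v x = k)"
    by (rule reflpI) simp
  show "symp (\<lambda>u v :: 'a \<Rightarrow> real. \<exists>k. \<forall>x. u x - v x = k)"
    by (rule sympI) (metis minus_diff_eq)
  show "transp (\<lambda>u v :: 'a \<Rightarrow> real. \<exists>k. \<forall>x. u x - v x = k)"
  proof (rule transpI)
    fix u v w :: "'a \<Rightarrow> real"
    assume "\<exists>k. \<forall>x. u x - v x = k" "\<exists>k. \<forall>x. v x - w x = k"
    then obtain k l where kl: "\<And>x. u x - v x = k" "\<And>x. v x - w x = l" by blast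
    have "u x - w x = k + l" for x using kl[of x] by linarith
    thus "\<exists>k. \<forall>x. u x - w x = k" by blast
  qed
qed

instantiation modconst :: (type) real_vector
begin

lift_definition zero_modconst :: "'a modconst" is "\<lambda>_. 0" .

lift_definition plus_modconst :: "'a modconst \<Rightarrow> 'a modconst \<Rightarrow> 'a modconst"
  is "\<lambda>u v x. u x + v x"
  proof (clarify)
  fix u u' v v' :: "'a \<Rightarrow> real" and k l
  assume "\<forall>x. u x - u' x = k" "\<forall>x. v x - v' x = l"
  hence "\<forall>x. (u x + v x) - (u' x + v' x) = k + l" by (smt (verit))
  thus "\<exists>k. \<forall>x. (u x + v x) - (u' x + v' x) = k" by blast
qed

lift_definition uminus_modconst :: "'a modconst \<Rightarrow> 'a modconst" is "\<lambda>u x. - u x"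
  by (metis minus_diff_minus)

lift_definition minus_modconst :: "'a modconst \<Rightarrow> 'a modconst \<Rightarrow> 'a modconst"
  is "\<lambda>u v x. u x - v x"
proof (clarify)
  fix u u' v v' :: "'a \<Rightarrow> real" and k l
  assume "\<forall>x. u x - u' x = k" "\<forall>x. v x - v' x = l"
  hence "(u x - v x) - (u' x - v' x) = k - l" for x
    by (smt (verit))
  thus "\<exists>k. \<forall>x. (u x - v x) - (u' x - v' x) = k" by blast
qed

lift_definition scaleR_modconst :: "real \<Rightarrow> 'a modconst \<Rightarrow> 'a modconst" is "\<lambda>r u x. r * u x"
  by (metis right_diff_distrib)

instance
  by standard (transfer, simp add: algebra_simps)+

end

lift_definition delta :: "'a \<Rightarrow> 'a modconst" is "\<lambda>x. indicator {x}" .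

lift_definition increment :: "'a modconst \<Rightarrow> 'a \<Rightarrow> 'a \<Rightarrow> real" is "\<lambda>u x y. u x - u y"
proof (intro ext)
  fix u u' :: "'a \<Rightarrow> real" and x y
  assume "\<exists>k. \<forall>x. u x - u' x = k"
  thus "u x - u y = u' x - u' y" by (smt (verit))
qed


text \<open>
  The vertex set is the whole type \<^typ>\<open>'a\<close>. Self-loops \<open>c x x > 0\<close> are not excluded;
  they contribute nothing to the Laplacian or the energy.
\<close>

locale network =
  fixes c :: "'a \<Rightarrow> 'a \<Rightarrow> real"
  assumes nonneg: "0 \<le> c x y"
    and sym: "c x y = c y x"
    and locally_finite: "finite {y. 0 < c x y}"
    and connected: "(\<lambda>x y. 0 < c x y)\<^sup>*\<^sup>* x y"

definition laplacian :: "('a \<Rightarrow> 'a \<Rightarrow> real) \<Rightarrow> ('a \<Rightarrow> real) \<Rightarrow> 'a \<Rightarrow> real"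
  where "laplacian c u x = (\<Sum>y | 0 < c x y. c x y * (u x - u y))"

lift_definition energy_form :: "('a \<Rightarrow> 'a \<Rightarrow> real) \<Rightarrow> 'a modconst \<Rightarrow> 'a modconst \<Rightarrow> real"
  is "\<lambda>c u v. (\<Sum>\<^sub>\<infinity>(x, y)\<in>UNIV. c x y * (u x - u y) * (v x - v y)) / 2"
proof -
  fix c :: "'a \<Rightarrow> 'a \<Rightarrow> real" and u u' v v' :: "'a \<Rightarrow> real"
  assume "\<exists>k. \<forall>x. u x - u' x = k" "\<exists>k. \<forall>x. v x - v' x = k"
  hence "u x - u y = u' x - u' y" "v x - v y = v' x - v' y" for x y
    by (smt (verit))+
  thus "(\<Sum>\<^sub>\<infinity>(x, y)\<in>UNIV. c x y * (u x - u y) * (v x - v y)) / 2 =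
    (\<Sum>\<^sub>\<infinity>(x, y)\<in>UNIV. c x y * (u' x - u' y) * (v' x - v' y)) / 2"
    by simp
qed

definition energy :: "('a \<Rightarrow> 'a \<Rightarrow> real) \<Rightarrow> 'a modconst \<Rightarrow> real"
  where "energy c u = energy_form c u u"

lift_definition finite_energy :: "('a \<Rightarrow> 'a \<Rightarrow> real) \<Rightarrow> 'a modconst \<Rightarrow> bool"
  is "\<lambda>c u. (\<lambda>(x, y). c x y * (u x - u y)\<^sup>2) summable_on UNIV"
proof -
  fix c :: "'a \<Rightarrow> 'a \<Rightarrow> real" and u u' :: "'a \<Rightarrow> real"
  assume "\<exists>k. \<forall>x. u x - u' x = k"
  hence "u x - u y = u' x - u' y" for x y
    by (smt (verit))
  thus "((\<lambda>(x, y). c x y * (u x - u y)\<^sup>2) summable_on UNIV) =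
    ((\<lambda>(x, y). c x y * (u' x - u' y)\<^sup>2) summable_on UNIV)"
    by simp
qed

lift_definition laplacian_modconst :: "('a \<Rightarrow> 'a \<Rightarrow> real) \<Rightarrow> 'a modconst \<Rightarrow> 'a \<Rightarrow> real"
  is laplacian
proof -
  fix c :: "'a \<Rightarrow> 'a \<Rightarrow> real" and u u' :: "'a \<Rightarrow> real"
  assume "\<exists>k. \<forall>x. u x - u' x = k"
  hence "u x - u y = u' x - u' y" for x y
    by (smt (verit))
  thus "laplacian c u = laplacian c u'"
    by (simp add: laplacian_def fun_eq_iff)
qed

definition energy_space :: "('a \<Rightarrow> 'a \<Rightarrow> real) \<Rightarrow> 'a modconst set"
  where "energy_space c = {u. finite_energy c u}"

definition transient :: "('a \<Rightarrow> 'a \<Rightarrow> real) \<Rightarrow> bool"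
  where "transient c \<longleftrightarrow> (\<exists>x. \<exists>w\<in>energy_space c. laplacian_modconst c w = indicator {x})"

text \<open>In the following, \<open>a\<close> is the reference vertex.\<close>

definition energy_kernel :: "('a \<Rightarrow> 'a \<Rightarrow> real) \<Rightarrow> 'a \<Rightarrow> 'a \<Rightarrow> 'a modconst"
  where "energy_kernel c a x =
    (THE v. v \<in> energy_space c \<and> (\<forall>u\<in>energy_space c. energy_form c v u = increment u x a))"

text \<open>
  The closure is taken in the energy norm, which depends on \<open>c\<close> and so does not give a topology on
  the type.
\<close>

definition Fin :: "('a \<Rightarrow> 'a \<Rightarrow> real) \<Rightarrow> 'a modconst set"
  where "Fin c = {u \<in> energy_space c. \<forall>e>0. \<exists>g\<in>span (range delta). energy c (u - g) < e}"

definition proj_Fin :: "('a \<Rightarrow> 'a \<Rightarrow> real) \<Rightarrow> 'a modconst \<Rightarrow> 'a modconst"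
  where "proj_Fin c v = (THE f. f \<in> Fin c \<and> (\<forall>g\<in>Fin c. energy_form c (v - f) g = 0))"

definition wired_resistance :: "('a \<Rightarrow> 'a \<Rightarrow> real) \<Rightarrow> 'a \<Rightarrow> 'a \<Rightarrow> 'a \<Rightarrow> real"
  where "wired_resistance c a x y =
    energy c (proj_Fin c (energy_kernel c a x) - proj_Fin c (energy_kernel c a y))"


text \<open>
  Unbounded operators are represented by their graphs, so that the closure of an operator is the
  topological closure of its graph in the product space.
\<close>

definition laplacian2 :: "('a \<Rightarrow> 'a \<Rightarrow> real) \<Rightarrow> ('a ell2 \<times> 'a ell2) set"
  where "laplacian2 c =
    closure {(u, w). u \<in> span (range delta2) \<and> fun_of w = laplacian c (fun_of u)}"

definition orthogonal_projection :: "('h::real_inner \<Rightarrow> 'h) \<Rightarrow> bool"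
  where "orthogonal_projection p \<longleftrightarrow>
    bounded_linear p \<and> p \<circ> p = p \<and> (\<forall>u v. inner (p u) v = inner u (p v))"

definition projection_valued_measure :: "(real set \<Rightarrow> 'h::{real_inner, complete_space} \<Rightarrow> 'h) \<Rightarrow> bool"
  where "projection_valued_measure P \<longleftrightarrow>
    (\<forall>A\<in>sets borel. orthogonal_projection (P A)) \<and>
    P {} = (\<lambda>_. 0) \<and> P UNIV = id \<and>
    (\<forall>A\<in>sets borel. \<forall>B\<in>sets borel. P (A \<inter> B) = P A \<circ> P B) \<and>
    (\<forall>A :: nat \<Rightarrow> real set. range A \<subseteq> sets borel \<longrightarrow> disjoint_family A \<longrightarrow>
      (\<forall>u. (\<lambda>n. P (A n) u) sums P (\<Union>n. A n) u))"

definition scalar_measure :: "(real set \<Rightarrow> 'h::{real_inner, complete_space} \<Rightarrow> 'h) \<Rightarrow> 'h \<Rightarrow> real measure"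
  where "scalar_measure P u = measure_of UNIV (sets borel) (\<lambda>A. ennreal ((norm (P A u))\<^sup>2))"

lemma sets_scalar_measure [simp, measurable_cong]: "sets (scalar_measure P u) = sets borel"
  unfolding scalar_measure_def by (simp add: sets_measure_of_conv sets.sigma_sets_eq[of borel, simplified])

lemma space_scalar_measure [simp]: "space (scalar_measure P u) = UNIV"
  unfolding scalar_measure_def by (simp add: space_measure_of_conv)

lemma emeasure_scalar_measure:
  assumes P: "projection_valued_measure P" and A: "A \<in> sets borel"
  shows "emeasure (scalar_measure P u) A = ennreal ((norm (P A u))\<^sup>2)"
proof -
  have sq: "(norm (P B u))\<^sup>2 = inner u (P B u)" if "B \<in> sets borel" for B
  proof -
    have "orthogonal_projection (P B)"
      using P that unfolding projection_valued_measure_def by blast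
    thus ?thesis unfolding orthogonal_projection_def power2_norm_eq_inner
      by (metis comp_apply)
  qed
  have "countably_additive (sets borel) (\<lambda>A. ennreal ((norm (P A u))\<^sup>2))"
    unfolding countably_additive_def
  proof (intro allI impI)
    fix B :: "nat \<Rightarrow> real set"
    assume B: "range B \<subseteq> sets borel" "disjoint_family B" "\<Union> (range B) \<in> sets borel"
    have "(\<lambda>n. P (B n) u) sums P (\<Union>n. B n) u"
      using P B unfolding projection_valued_measure_def by blast
    hence "(\<lambda>n. inner u (P (B n) u)) sums inner u (P (\<Union>n. B n) u)"
      by (rule bounded_linear.sums[OF bounded_linear_inner_right])
    hence "(\<lambda>n. (norm (P (B n) u))\<^sup>2) sums (norm (P (\<Union>n. B n) u))\<^sup>2"
      using B by (simp add: sq image_subset_iff)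
    hence "(\<lambda>n. ennreal ((norm (P (B n) u))\<^sup>2)) sums ennreal ((norm (P (\<Union>n. B n) u))\<^sup>2)"
      by simp
    thus "(\<Sum>n. ennreal ((norm (P (B n) u))\<^sup>2)) = ennreal ((norm (P (\<Union> (range B)) u))\<^sup>2)"
      by (rule sums_unique[symmetric])
  qed
  moreover have "positive (sets borel) (\<lambda>A. ennreal ((norm (P A u))\<^sup>2))"
    using P by (simp add: positive_def projection_valued_measure_def)
  ultimately show ?thesis
    by (intro emeasure_measure_of[OF scalar_measure_def])
      (use A in \<open>simp_all add: sets_scalar_measure\<close>)
qed

text \<open>
  The spectral theorem writes a self-adjoint operator \<open>T\<close> as the integral of \<open>\<lambda>\<close> against \<open>P\<close>,
  with domain the vectors \<open>u\<close> for which \<open>\<lambda>\<^sup>2\<close> is integrable against the measure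
  sending \<open>A\<close> to \<open>\<parallel>P(A) u\<parallel>\<^sup>2\<close>. This integral is
  determined by the pairings with a dense set of vectors \<open>v\<close>. The signed measure sending
  \<open>A\<close> to \<open>\<langle>P(A) u, v\<rangle>\<close>, against which \<open>\<lambda>\<close> is to be integrated for that, is
  written by polarization as a difference of positive measures; \<open>v\<close> ranges over the (dense)
  domain so that both integrals are finite.
\<close>

definition spectral_domain :: "(real set \<Rightarrow> 'h::{real_inner, complete_space} \<Rightarrow> 'h) \<Rightarrow> 'h set"
  where "spectral_domain P = {u. integrable (scalar_measure P u) (\<lambda>t. t\<^sup>2)}"

definition spectral_form :: "(real set \<Rightarrow> 'h::{real_inner, complete_space} \<Rightarrow> 'h) \<Rightarrow> 'h \<Rightarrow> 'h \<Rightarrow> real"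
  where "spectral_form P u v =
    ((\<integral>t. t \<partial>scalar_measure P (u + v)) - (\<integral>t. t \<partial>scalar_measure P (u - v))) / 4"

definition spectral_measure_of ::
    "('h \<times> 'h) set \<Rightarrow> (real set \<Rightarrow> 'h::{real_inner, complete_space} \<Rightarrow> 'h) \<Rightarrow> bool"
  where "spectral_measure_of T P \<longleftrightarrow>
    projection_valued_measure P \<and>
    T = {(u, w). u \<in> spectral_domain P \<and> (\<forall>v\<in>spectral_domain P. inner w v = spectral_form P u v)}"

end

theory Submission
  imports Defs
begin

text \<open>
  Write \<open>\<xi> = \<delta>\<^sub>x - \<delta>\<^sub>y\<close> and \<open>T = \<Delta>\<^sub>2\<close>. Both sides of the formula are the supremum of the Dirichlet functional
  \<open>D(g) = 2 \<langle>\<xi>, g\<rangle> - \<langle>T g, g\<rangle>\<close> over the domain of \<open>T\<close>.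
  
  For the wired resistance this is Dirichlet's principle. The vector \<open>f = f\<^sub>x - f\<^sub>y\<close> lies in \<open>Fin\<close> and
  satisfies \<open>\<E>(f, g) = g(x) - g(y) = \<langle>\<xi>, g\<rangle>\<close> for \<open>g\<close> in \<open>Fin\<close>, while \<open>\<langle>\<Delta> g, g\<rangle> = \<E>(g)\<close> for finitely supported
  \<open>g\<close>. Completing the square gives \<open>D(g) = \<E>(f) - \<E>(f - g)\<close> (\<open>wired_resistance_completed_square\<close>). So
  \<open>D \<le> \<E>(f)\<close> on finitely supported \<open>g\<close>, with approximate equality because these are dense in \<open>Fin\<close>. As
  \<open>D\<close> is continuous in the graph norm and \<open>T\<close> is the closure of its restriction to finitely supported
  functions, the bound holds on the whole domain of \<open>T\<close> (\<open>dirichlet_le_wired_resistance\<close>,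
  \<open>dirichlet_approx_wired_resistance\<close>). The existence of \<open>f\<close> rests on completeness of the energy space,
  which the discrete gradient embeds as a closed subspace into the square-summable functions on
  pairs of vertices.
  
  For the spectral integral the reason is that \<open>2 s - t s\<^sup>2\<close> has the maximum \<open>1/t\<close> over \<open>s\<close> when \<open>t > 0\<close>.
  Testing \<open>D\<close> on \<open>g = h(T) \<xi>\<close> with simple functions \<open>h \<le> 1/t\<close> shows that the integral of \<open>1/t\<close> is at most
  any upper bound of \<open>D\<close> (\<open>inverse_moment_le_of_dirichlet_bound\<close>); these test vectors are available
  because, by self-adjointness, the domain of \<open>T\<close> is the full spectral domain. Conversely, the
  arithmetic-geometric mean inequality on the pieces of a geometric partition of the half-line,
  whose ratio tends to \<open>1\<close>, bounds \<open>D(g)\<close> by the integral (\<open>dirichlet_le_inverse_moment\<close>); here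
  positivity of \<open>T\<close> removes the negative half-line. An atom of \<open>\<xi>\<close> at \<open>0\<close> would make the integral
  infinite, so the first inequality also shows that there is none.
\<close>

section \<open>Riesz representation on a closed subspace\<close>

text \<open>
  The representing vector is the minimiser of \<open>\<parallel>u\<parallel>\<^sup>2 - 2 \<phi>(u)\<close> over \<open>S\<close>. The parallelogram law makes
  every minimising sequence Cauchy, and a minimiser has vanishing first variation, which is the
  claim. Applied to the functional \<open>\<langle>v, -\<rangle>\<close> it yields the orthogonal projection of \<open>v\<close> onto \<open>S\<close>.
\<close>
lemma riesz_on_closed_subspace:
  fixes S :: "'h::{real_inner, complete_space} set" and \<phi> :: "'h \<Rightarrow> real"
  assumes S: "subspace S" "closed S"
    and add: "\<And>u v. u \<in> S \<Longrightarrow> v \<in> S \<Longrightarrow> \<phi> (u + v) = \<phi> u + \<phi> v"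
    and scale: "\<And>r u. u \<in> S \<Longrightarrow> \<phi> (r *\<^sub>R u) = r * \<phi> u"
    and bound: "\<And>u. u \<in> S \<Longrightarrow> \<bar>\<phi> u\<bar> \<le> C * norm u"
  shows "\<exists>v\<in>S. \<forall>u\<in>S. inner v u = \<phi> u"
proof -
  define J where "J u = (norm u)\<^sup>2 - 2 * \<phi> u" for u
  have diff: "\<phi> (u - v) = \<phi> u - \<phi> v" if "u \<in> S" "v \<in> S" for u v
    using add[of u "(-1) *\<^sub>R v"] scale[of v "-1"] that S by (simp add: subspace_scale subspace_neg)
  have lower: "- C\<^sup>2 \<le> J u" if "u \<in> S" for u
  proof -
    have "0 \<le> (norm u - C)\<^sup>2" by simp
    then have "2 * (C * norm u) \<le> (norm u)\<^sup>2 + C\<^sup>2" by (simp add: power2_diff mult_ac)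
    then show ?thesis using bound[OF that] unfolding J_def by linarith
  qed
  define m where "m = Inf (J ` S)"
  have ne: "J ` S \<noteq> {}" using S subspace_0 by blast
  have bdd: "bdd_below (J ` S)" using lower by (auto intro!: bdd_belowI[of _ "- C\<^sup>2"])
  have m_le: "m \<le> J u" if "u \<in> S" for u
    unfolding m_def using that bdd by (intro cInf_lower) auto
  have "\<exists>u\<in>S. J u < m + inverse (real (Suc n))" for n
  proof -
    have "Inf (J ` S) < m + inverse (real (Suc n))" unfolding m_def by simp
    then show ?thesis using cInf_lessD[OF ne] by auto
  qed
  then obtain u where u: "\<And>n. u n \<in> S" "\<And>n. J (u n) < m + inverse (real (Suc n))"
    by metis
  have parallelogram: "(norm (p - q))\<^sup>2 / 2 \<le> J p + J q - 2 * m" if "p \<in> S" "q \<in> S" for p q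
  proof -
    have mid: "(1/2) *\<^sub>R (p + q) \<in> S" using that S by (simp add: subspace_scale subspace_add)
    have "\<phi> ((1/2) *\<^sub>R (p + q)) = (\<phi> p + \<phi> q) / 2"
      using that S by (simp add: scale add subspace_add)
    then have "J p + J q - 2 * J ((1/2) *\<^sub>R (p + q)) = (norm (p - q))\<^sup>2 / 2"
      unfolding J_def power2_norm_eq_inner
      by (simp add: inner_simps inner_commute algebra_simps power_divide)
    then show ?thesis using m_le[OF mid] by simp
  qed
  have "Cauchy u"
  proof (rule metric_CauchyI)
    fix e :: real assume e: "0 < e"
    then obtain N where N: "inverse (real (Suc N)) < e\<^sup>2 / 4"
      using reals_Archimedean[of "e\<^sup>2 / 4"] by auto
    have "dist (u i) (u j) < e" if "i \<ge> N" "j \<ge> N" for i j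
    proof -
      have "inverse (real (Suc i)) \<le> inverse (real (Suc N))"
        "inverse (real (Suc j)) \<le> inverse (real (Suc N))" using that by (auto intro!: le_imp_inverse_le)
      then have "(norm (u i - u j))\<^sup>2 < e\<^sup>2"
        using parallelogram[OF u(1) u(1), of i j] u(2)[of i] u(2)[of j] N by linarith
      then show ?thesis using e by (simp add: dist_norm power2_less_imp_less)
    qed
    then show "\<exists>M. \<forall>i\<ge>M. \<forall>j\<ge>M. dist (u i) (u j) < e" by blast
  qed
  then obtain v where v: "u \<longlonglongrightarrow> v" using Cauchy_convergent convergentD by blast
  have vS: "v \<in> S" using S(2) u(1) v closed_sequentially by blast
  have "(\<lambda>n. C * norm (u n - v)) \<longlonglongrightarrow> 0"
    using tendsto_mult_right_zero[OF tendsto_norm_zero[OF LIM_zero[OF v]]] .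
  then have "(\<lambda>n. \<phi> (u n - v)) \<longlonglongrightarrow> 0"
    by (rule Lim_null_comparison[rotated]) (use bound subspace_diff[OF S(1) u(1) vS] in auto)
  then have "(\<lambda>n. \<phi> (u n)) \<longlonglongrightarrow> \<phi> v" using diff[OF u(1) vS] by (simp add: LIM_zero_iff)
  then have "(\<lambda>n. J (u n)) \<longlonglongrightarrow> J v" unfolding J_def by (intro tendsto_intros v)
  moreover have "(\<lambda>n. m + inverse (real (Suc n))) \<longlonglongrightarrow> m + 0"
    by (intro tendsto_intros LIMSEQ_inverse_real_of_nat)
  ultimately have Jv: "J v \<le> m" using u(2) by (intro LIMSEQ_le) (auto intro: less_imp_le)
  have "inner v p = \<phi> p" if p: "p \<in> S" for p
  proof (rule ccontr)
    assume neq: "inner v p \<noteq> \<phi> p"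
    \<comment> \<open>The first variation at \<open>v\<close> in direction \<open>p\<close> is \<open>2 d\<close>. If it does not vanish, a step of
        length \<open>- d / s\<close> along \<open>p\<close> decreases \<open>J\<close>, where adding \<open>1\<close> in \<open>s\<close> keeps the quadratic
        term strictly smaller than the gain.\<close>
    define d where "d = inner v p - \<phi> p"
    define s where "s = (norm p)\<^sup>2 + 1"
    have s: "s > 0" unfolding s_def by (simp add: add_nonneg_pos)
    have "v + (- d / s) *\<^sub>R p \<in> S" using vS p S by (intro subspace_add subspace_scale)
    then have "J v \<le> J (v + (- d / s) *\<^sub>R p)" using Jv m_le by force
    also have "J (v + k *\<^sub>R p) = J v + 2 * k * d + k\<^sup>2 * (norm p)\<^sup>2" for k
    proof -
      have "\<phi> (v + k *\<^sub>R p) = \<phi> v + k * \<phi> p"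
        by (simp add: add[OF vS subspace_scale[OF S(1) p]] scale[OF p])
      moreover have "(norm (v + k *\<^sub>R p))\<^sup>2 = (norm v)\<^sup>2 + 2 * k * inner v p + k\<^sup>2 * (norm p)\<^sup>2"
        unfolding power2_norm_eq_inner
        by (simp add: inner_simps inner_commute algebra_simps power2_eq_square)
      ultimately show ?thesis unfolding J_def d_def by (simp add: algebra_simps)
    qed
    also have "J v + 2 * (- d / s) * d + (- d / s)\<^sup>2 * (norm p)\<^sup>2
        = J v - 2 * (d * (d / s)) + (d / s)\<^sup>2 * (norm p)\<^sup>2" by simp
    also have "\<dots> < J v"
    proof -
      have "(d / s)\<^sup>2 * (norm p)\<^sup>2 < (d / s)\<^sup>2 * s"
        using neq s unfolding d_def by (intro mult_strict_left_mono) (auto simp: s_def)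
      also have "\<dots> = d * (d / s)" using s by (simp add: power2_eq_square)
      finally have "(d / s)\<^sup>2 * (norm p)\<^sup>2 < d * (d / s)" .
      moreover have "0 \<le> d * (d / s)" using s by simp
      ultimately show ?thesis by linarith
    qed
    finally show False by simp
  qed
  with vS show ?thesis by blast
qed

section \<open>Square-summable functions and functions modulo constants\<close>
lemma subspace_closure:
  fixes S :: "'h::real_normed_vector set"
  assumes "subspace S"
  shows "subspace (closure S)"
  unfolding subspace_def
proof (intro conjI ballI allI)
  show "0 \<in> closure S" using subspace_0[OF assms] closure_subset by blast
  fix u assume "u \<in> closure S"
  then obtain f where f: "\<And>n. f n \<in> S" "f \<longlonglongrightarrow> u" unfolding closure_sequential by blast
  show "r *\<^sub>R u \<in> closure S" for r
    unfolding closure_sequential using f subspace_scale[OF assms]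
    by (intro exI[of _ "\<lambda>n. r *\<^sub>R f n"]) (auto intro!: tendsto_intros)
  fix v assume "v \<in> closure S"
  then obtain g where g: "\<And>n. g n \<in> S" "g \<longlonglongrightarrow> v" unfolding closure_sequential by blast
  show "u + v \<in> closure S"
    unfolding closure_sequential using f g subspace_add[OF assms]
    by (intro exI[of _ "\<lambda>n. f n + g n"]) (auto intro!: tendsto_intros)
qed

lemma fun_of_add: "fun_of (u + v) x = fun_of u x + fun_of v x"
  by (simp add: plus_ell2.rep_eq)

lemma fun_of_scaleR: "fun_of (r *\<^sub>R u) x = r * fun_of u x"
  by (simp add: scaleR_ell2.rep_eq)

lemma fun_of_zero: "fun_of 0 x = 0"
  by (simp add: zero_ell2.rep_eq)

lemma ell2_eqI: "(\<And>x. fun_of u x = fun_of v x) \<Longrightarrow> u = v"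
  using fun_of_inject by blast

lemma inner_delta2: "inner u (delta2 x) = fun_of u x"
proof -
  have "inner u (delta2 x) = (\<Sum>\<^sub>\<infinity>y\<in>UNIV. fun_of u y * indicator {x} y)"
    by (simp add: inner_ell2.rep_eq delta2.rep_eq)
  also have "\<dots> = (\<Sum>\<^sub>\<infinity>y\<in>{x}. fun_of u y)"
    by (rule infsum_cong_neutral) auto
  finally show ?thesis by simp
qed

lemma increment_add: "increment (u + v) x y = increment u x y + increment v x y"
  by transfer simp

lemma increment_diff: "increment (u - v) x y = increment u x y - increment v x y"
  by transfer simp

lemma increment_scaleR: "increment (r *\<^sub>R u) x y = r * increment u x y"
  by transfer (simp add: right_diff_distrib)

lemma modconst_eqI: "(\<And>x y. increment u x y = increment v x y) \<Longrightarrow> u = v"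
proof transfer
  fix u v :: "'a \<Rightarrow> real"
  assume eq: "\<And>x y. u x - u y = v x - v y"
  have "u x - v x = u undefined - v undefined" for x using eq[of x undefined] by linarith
  then show "\<exists>k. \<forall>x. u x - v x = k" by blast
qed

lemma increment_abs_modconst: "increment (abs_modconst u) x y = u x - u y"
  by (simp add: increment.abs_eq)

section \<open>The energy space inside the square-summable functions on edges\<close>

text \<open>
  The discrete gradient. The weight \<open>sqrt (c x y / 2)\<close> turns the energy form, a sum over ordered
  pairs with the factor \<open>1/2\<close>, into the inner product of square-summable functions of pairs. The
  energy space thereby becomes a subspace of a genuine Hilbert space. Off the energy space the
  value is arbitrary.
\<close>
definition grad :: "('a \<Rightarrow> 'a \<Rightarrow> real) \<Rightarrow> 'a modconst \<Rightarrow> ('a \<times> 'a) ell2"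
  where "grad c u = Abs_ell2 (\<lambda>(x, y). sqrt (c x y / 2) * increment u x y)"

definition mod_const :: "'a ell2 \<Rightarrow> 'a modconst"
  where "mod_const u = abs_modconst (fun_of u)"

lemma increment_mod_const: "increment (mod_const u) x y = fun_of u x - fun_of u y"
  by (simp add: mod_const_def increment_abs_modconst)

lemma linear_mod_const: "linear mod_const"
  by (rule linearI; rule modconst_eqI)
    (simp_all add: increment_mod_const increment_add increment_scaleR fun_of_add fun_of_scaleR
      algebra_simps)

lemma mod_const_delta2: "mod_const (delta2 x) = delta x"
  by (simp add: mod_const_def delta2.rep_eq delta.abs_eq)

lemma span_delta_eq: "span (range delta) = mod_const ` span (range delta2)"
proof -
  have "range (delta :: 'a \<Rightarrow> _) = mod_const ` range delta2"
    by (simp add: image_image mod_const_delta2)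
  then show ?thesis by (simp only: linear_span_image[OF linear_mod_const])
qed

context network
begin

lemma mem_energy_space_iff:
  "u \<in> energy_space c \<longleftrightarrow> (\<lambda>p. (sqrt (c (fst p) (snd p) / 2) * increment u (fst p) (snd p))\<^sup>2) summable_on UNIV"
proof -
  have "u \<in> energy_space c \<longleftrightarrow> (\<lambda>p. c (fst p) (snd p) * (increment u (fst p) (snd p))\<^sup>2) summable_on UNIV"
    unfolding energy_space_def mem_Collect_eq by transfer (simp add: case_prod_unfold)
  also have "\<dots> \<longleftrightarrow> (\<lambda>p. (1/2) * (c (fst p) (snd p) * (increment u (fst p) (snd p))\<^sup>2)) summable_on UNIV"
    by (subst summable_on_cmult_right') auto
  finally show ?thesis using nonneg by (simp add: power_mult_distrib)
qed

lemma fun_of_grad: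
  assumes "u \<in> energy_space c"
  shows "fun_of (grad c u) (x, y) = sqrt (c x y / 2) * increment u x y"
proof -
  have "fun_of (grad c u) = (\<lambda>(x, y). sqrt (c x y / 2) * increment u x y)"
    unfolding grad_def using assms[unfolded mem_energy_space_iff]
    by (intro Abs_ell2_inverse) (simp add: case_prod_unfold)
  then show ?thesis by simp
qed

lemma subspace_energy_space: "subspace (energy_space c)"
  unfolding subspace_def
proof (intro conjI ballI allI)
  have "increment 0 x y = 0" for x y :: 'a by transfer simp
  then show "0 \<in> energy_space c" by (simp add: mem_energy_space_iff)
  fix u assume u: "u \<in> energy_space c"
  show "u + v \<in> energy_space c" if "v \<in> energy_space c" for v
    using square_summable_add[OF u[unfolded mem_energy_space_iff] that[unfolded mem_energy_space_iff]]
    by (simp add: mem_energy_space_iff increment_add distrib_left)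
  show "r *\<^sub>R u \<in> energy_space c" for r
    using square_summable_scale[OF u[unfolded mem_energy_space_iff], of r]
    by (simp add: mem_energy_space_iff increment_scaleR mult.left_commute)
qed

lemma grad_add: "u \<in> energy_space c \<Longrightarrow> v \<in> energy_space c \<Longrightarrow> grad c (u + v) = grad c u + grad c v"
  by (rule ell2_eqI)
    (auto simp: fun_of_grad subspace_add[OF subspace_energy_space] fun_of_add increment_add distrib_left)

lemma grad_scaleR: "u \<in> energy_space c \<Longrightarrow> grad c (r *\<^sub>R u) = r *\<^sub>R grad c u"
  by (rule ell2_eqI)
    (auto simp: fun_of_grad subspace_scale[OF subspace_energy_space] fun_of_scaleR increment_scaleR)

lemma grad_diff: "u \<in> energy_space c \<Longrightarrow> v \<in> energy_space c \<Longrightarrow> grad c (u - v) = grad c u - grad c v"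
  by (rule ell2_eqI)
    (auto simp: fun_of_grad subspace_diff[OF subspace_energy_space] fun_of_diff increment_diff right_diff_distrib)

lemma energy_form_eq_inner:
  assumes "u \<in> energy_space c" "v \<in> energy_space c"
  shows "energy_form c u v = inner (grad c u) (grad c v)"
proof -
  have "energy_form c u v = (\<Sum>\<^sub>\<infinity>p. c (fst p) (snd p) * increment u (fst p) (snd p) * increment v (fst p) (snd p)) / 2"
    by transfer (simp add: case_prod_unfold)
  also have "\<dots> = (\<Sum>\<^sub>\<infinity>p. (1/2) * (c (fst p) (snd p) * increment u (fst p) (snd p) * increment v (fst p) (snd p)))"
    by (subst infsum_cmult_right') simp
  also have "\<dots> = (\<Sum>\<^sub>\<infinity>p. fun_of (grad c u) p * fun_of (grad c v) p)"
  proof (rule infsum_cong)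
    fix p :: "'a \<times> 'a"
    obtain x y where p: "p = (x, y)" by fastforce
    have "fun_of (grad c u) p * fun_of (grad c v) p
        = (sqrt (c x y / 2) * sqrt (c x y / 2)) * (increment u x y * increment v x y)"
      using assms by (simp add: p fun_of_grad mult_ac)
    also have "sqrt (c x y / 2) * sqrt (c x y / 2) = c x y / 2"
      using nonneg by simp
    finally show "(1/2) * (c (fst p) (snd p) * increment u (fst p) (snd p) * increment v (fst p) (snd p))
        = fun_of (grad c u) p * fun_of (grad c v) p"
      by (simp add: p)
  qed
  finally show ?thesis by (simp add: inner_ell2.rep_eq)
qed

text \<open>
  Along one edge the increment is the gradient divided by \<open>sqrt (c x y / 2)\<close>; adding up the edges
  of a path from \<open>x\<close> to \<open>y\<close> makes every increment a bounded functional of the gradient. This single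
  consequence of connectedness gives injectivity of the gradient, completeness of the energy space
  and the existence of the energy kernel.
\<close>
lemma increment_bounded: "\<exists>C\<ge>0. \<forall>u\<in>energy_space c. \<bar>increment u x y\<bar> \<le> C * norm (grad c u)"
proof -
  have "(\<lambda>x y. 0 < c x y)\<^sup>*\<^sup>* x y" by (rule connected)
  then show ?thesis
  proof induction
    case base
    have "increment u x x = 0" for u :: "'a modconst" by transfer simp
    then show ?case by (intro exI[of _ 0]) simp
  next
    case (step y z)
    then obtain C where C: "C \<ge> 0" "\<And>u. u \<in> energy_space c \<Longrightarrow> \<bar>increment u x y\<bar> \<le> C * norm (grad c u)"
      by blast
    define s where "s = sqrt (c y z / 2)"
    have s: "s > 0" using step.hyps(2) by (simp add: s_def)
    have "\<bar>increment u x z\<bar> \<le> (C + 1 / s) * norm (grad c u)" if u: "u \<in> energy_space c" for u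
    proof -
      have "\<bar>s * increment u y z\<bar> \<le> norm (grad c u)"
        using fun_of_le_norm[of "grad c u" "(y, z)"] by (simp add: fun_of_grad[OF u] s_def)
      then have "\<bar>increment u y z\<bar> \<le> 1 / s * norm (grad c u)"
        using s by (simp add: abs_mult field_simps)
      moreover have "increment u x z = increment u x y + increment u y z" by transfer simp
      ultimately show ?thesis using C(2)[OF u] by (simp add: distrib_right)
    qed
    then show ?case using C(1) s by (intro exI[of _ "C + 1 / s"]) auto
  qed
qed

lemma grad_inject:
  assumes "u \<in> energy_space c" "v \<in> energy_space c" "grad c u = grad c v"
  shows "u = v"
proof (rule modconst_eqI)
  fix x y
  obtain C where "\<forall>u\<in>energy_space c. \<bar>increment u x y\<bar> \<le> C * norm (grad c u)"
    using increment_bounded by blast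
  from bspec[OF this, of "u - v"] show "increment u x y = increment v x y"
    using assms by (simp add: subspace_diff[OF subspace_energy_space] grad_diff increment_diff)
qed

text \<open>
  Completeness of the energy space. If gradients converge, then so do all increments, and
  normalising the limit at one vertex integrates them to a function whose gradient is the limit.
\<close>
lemma closed_grad_energy_space: "closed (grad c ` energy_space c)"
proof (unfold closed_sequential_limits, intro allI impI, elim conjE)
  fix X l
  assume "\<forall>n. X n \<in> grad c ` energy_space c" and lim: "X \<longlonglongrightarrow> l"
  then obtain u where u: "\<And>n. u n \<in> energy_space c" "\<And>n. X n = grad c (u n)"
    unfolding image_iff by metis
  have Cauchy_X: "Cauchy X" using lim by (rule LIMSEQ_imp_Cauchy)
  have conv: "convergent (\<lambda>n. increment (u n) x y)" for x y
  proof -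
    obtain C where C: "C \<ge> 0" "\<And>u. u \<in> energy_space c \<Longrightarrow> \<bar>increment u x y\<bar> \<le> C * norm (grad c u)"
      using increment_bounded by blast
    have d: "dist (increment (u m) x y) (increment (u n) x y) \<le> C * dist (X m) (X n)" for m n
      using C(2)[of "u m - u n"] u
      by (simp add: dist_norm grad_diff increment_diff subspace_diff[OF subspace_energy_space])
    have "Cauchy (\<lambda>n. increment (u n) x y)"
    proof (rule metric_CauchyI)
      fix e :: real assume e: "0 < e"
      then have "0 < e / (C + 1)" using C(1) by simp
      then obtain M where M: "\<And>m n. m \<ge> M \<Longrightarrow> n \<ge> M \<Longrightarrow> dist (X m) (X n) < e / (C + 1)"
        using metric_CauchyD[OF Cauchy_X] by blast
      have "dist (increment (u m) x y) (increment (u n) x y) < e" if "m \<ge> M" "n \<ge> M" for m n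
      proof -
        have "C * dist (X m) (X n) \<le> (C + 1) * dist (X m) (X n)"
          by (intro mult_right_mono) auto
        also have "\<dots> < (C + 1) * (e / (C + 1))"
          using M[OF that] C(1) by (intro mult_strict_left_mono) auto
        finally show ?thesis using d[of m n] C(1) by simp
      qed
      then show "\<exists>M. \<forall>m\<ge>M. \<forall>n\<ge>M. dist (increment (u m) x y) (increment (u n) x y) < e" by blast
    qed
    then show ?thesis by (rule Cauchy_convergent)
  qed
  define U where "U x = lim (\<lambda>n. increment (u n) x undefined)" for x
  have U: "(\<lambda>n. increment (u n) x y) \<longlonglongrightarrow> U x - U y" for x y
  proof -
    have "(\<lambda>n. increment (u n) x undefined - increment (u n) y undefined) \<longlonglongrightarrow> U x - U y"
      unfolding U_def by (intro tendsto_diff convergent_LIMSEQ_iff[THEN iffD1] conv)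
    moreover have "increment v x undefined - increment v y undefined = increment v x y" for v :: "'a modconst"
      by transfer simp
    ultimately show ?thesis by simp
  qed
  have l: "fun_of l (x, y) = sqrt (c x y / 2) * (U x - U y)" for x y
  proof (rule LIMSEQ_unique)
    have "(\<lambda>n. norm (X n - l)) \<longlonglongrightarrow> 0" using lim by (simp add: LIM_zero tendsto_norm_zero)
    then have "(\<lambda>n. fun_of (X n) (x, y) - fun_of l (x, y)) \<longlonglongrightarrow> 0"
      by (rule Lim_null_comparison[rotated])
        (use fun_of_le_norm[of "X _ - l" "(x, y)"] in \<open>auto simp: fun_of_diff\<close>)
    then show "(\<lambda>n. fun_of (X n) (x, y)) \<longlonglongrightarrow> fun_of l (x, y)" by (simp add: LIM_zero_iff)
    show "(\<lambda>n. fun_of (X n) (x, y)) \<longlonglongrightarrow> sqrt (c x y / 2) * (U x - U y)"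
      unfolding u(2) fun_of_grad[OF u(1)] by (intro tendsto_intros U)
  qed
  have incr: "increment (abs_modconst U) x y = U x - U y" for x y
    by (rule increment_abs_modconst)
  have mem: "abs_modconst U \<in> energy_space c"
    unfolding mem_energy_space_iff incr l[symmetric] prod.collapse by (rule fun_of_summable)
  have "grad c (abs_modconst U) = l"
    by (rule ell2_eqI) (auto simp: fun_of_grad[OF mem] incr l)
  then show "l \<in> grad c ` energy_space c" using mem by blast
qed

lemma subspace_grad_image:
  assumes "subspace S" "S \<subseteq> energy_space c"
  shows "subspace (grad c ` S)"
  unfolding subspace_def
proof (intro conjI ballI allI)
  show "0 \<in> grad c ` S"
    using grad_scaleR[of 0 0] subspace_0[OF assms(1)] subspace_0[OF subspace_energy_space] by force
  fix p assume "p \<in> grad c ` S"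
  then obtain u where u: "u \<in> S" "p = grad c u" by blast
  show "r *\<^sub>R p \<in> grad c ` S" for r
    using u assms(2) subspace_scale[OF assms(1)] by (auto simp: grad_scaleR[symmetric] subset_iff)
  fix q assume "q \<in> grad c ` S"
  then obtain v where v: "v \<in> S" "q = grad c v" by blast
  show "p + q \<in> grad c ` S"
    using u v assms(2) subspace_add[OF assms(1)] by (auto simp: grad_add[symmetric] subset_iff)
qed

text \<open>
  The form of the Riesz representation that matches the definite descriptions in
  \<^const>\<open>energy_kernel\<close> and \<^const>\<open>proj_Fin\<close>.
\<close>
lemma ex1_energy_representer:
  assumes S: "subspace S" "S \<subseteq> energy_space c" "closed (grad c ` S)"
    and add: "\<And>u v. u \<in> S \<Longrightarrow> v \<in> S \<Longrightarrow> \<phi> (u + v) = \<phi> u + \<phi> v"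
    and scale: "\<And>r u. u \<in> S \<Longrightarrow> \<phi> (r *\<^sub>R u) = r * \<phi> u"
    and bound: "\<And>u. u \<in> S \<Longrightarrow> \<bar>\<phi> u\<bar> \<le> C * norm (grad c u)"
  shows "\<exists>!v. v \<in> S \<and> (\<forall>u\<in>S. energy_form c v u = \<phi> u)"
proof -
  have inj: "inj_on (grad c) S" using S(2) grad_inject by (meson inj_onI subsetD)
  define \<psi> where "\<psi> p = \<phi> (inv_into S (grad c) p)" for p
  have \<psi>: "\<psi> (grad c u) = \<phi> u" if "u \<in> S" for u
    unfolding \<psi>_def using inj that by simp
  have "\<exists>v\<in>grad c ` S. \<forall>u\<in>grad c ` S. inner v u = \<psi> u"
  proof (rule riesz_on_closed_subspace[OF subspace_grad_image[OF S(1,2)] S(3)])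
    fix p q assume "p \<in> grad c ` S" "q \<in> grad c ` S"
    then show "\<psi> (p + q) = \<psi> p + \<psi> q"
      using S(2) subspace_add[OF S(1)] by (auto simp: grad_add[symmetric] subset_iff \<psi> add)
  next
    fix p r assume "p \<in> grad c ` S"
    then show "\<psi> (r *\<^sub>R p) = r * \<psi> p"
      using S(2) subspace_scale[OF S(1)] by (auto simp: grad_scaleR[symmetric] subset_iff \<psi> scale)
  next
    fix p assume "p \<in> grad c ` S"
    then show "\<bar>\<psi> p\<bar> \<le> C * norm p" using bound by (auto simp: \<psi>)
  qed
  then obtain v where v: "v \<in> S" "\<And>u. u \<in> S \<Longrightarrow> inner (grad c v) (grad c u) = \<phi> u"
    by (auto simp: \<psi>)
  show ?thesis
  proof (rule ex1I[of _ v])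
    show "v \<in> S \<and> (\<forall>u\<in>S. energy_form c v u = \<phi> u)"
      using v S(2) by (auto simp: energy_form_eq_inner subset_iff)
  next
    fix v' assume v': "v' \<in> S \<and> (\<forall>u\<in>S. energy_form c v' u = \<phi> u)"
    then have d: "v' - v \<in> S" using v(1) S(1) by (simp add: subspace_diff)
    have "inner (grad c v') (grad c (v' - v)) = inner (grad c v) (grad c (v' - v))"
      using v' d v S(2) by (metis energy_form_eq_inner subsetD)
    then have "inner (grad c v' - grad c v) (grad c v' - grad c v) = 0"
      using v' v(1) S(2) by (simp add: grad_diff subset_iff inner_diff_left)
    then show "v' = v" using v' v(1) S(2) by (intro grad_inject) auto
  qed
qed

lemma delta_mem_energy_space: "delta z \<in> energy_space c"
proof -
  let ?N = "{y. 0 < c z y}"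
  have "(sqrt (c (fst p) (snd p) / 2) * increment (delta z) (fst p) (snd p))\<^sup>2 = 0"
    if "p \<notin> {z} \<times> ?N \<union> ?N \<times> {z}" for p
  proof -
    have "c (fst p) (snd p) = 0 \<or> (fst p \<noteq> z \<and> snd p \<noteq> z)"
      using that nonneg sym by (cases p) (auto simp: less_le)
    moreover have "increment (delta z) x y = indicator {z} x - indicator {z} y" for x y
      by transfer simp
    ultimately show ?thesis by auto
  qed
  then have "{p \<in> UNIV. (sqrt (c (fst p) (snd p) / 2) * increment (delta z) (fst p) (snd p))\<^sup>2 \<noteq> 0}
      \<subseteq> {z} \<times> ?N \<union> ?N \<times> {z}" by blast
  moreover have "finite ({z} \<times> ?N \<union> ?N \<times> {z})" using locally_finite by simp
  ultimately show ?thesis unfolding mem_energy_space_iff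
    by (intro finite_nonzero_values_imp_summable_on) (rule finite_subset)
qed

lemma span_delta_subset_energy_space: "span (range delta) \<subseteq> energy_space c"
  by (intro span_minimal subspace_energy_space) (use delta_mem_energy_space in auto)

text \<open>
  The closure that defines \<^const>\<open>Fin\<close> uses the squared energy norm; transported by the gradient it is a
  topological closure, so that the closure properties of closed subspaces become available.
\<close>
lemma mem_Fin_iff:
  "u \<in> Fin c \<longleftrightarrow> u \<in> energy_space c \<and> grad c u \<in> closure (grad c ` span (range delta))"
proof -
  have energy: "energy c (u - g) = (dist (grad c g) (grad c u))\<^sup>2"
    if "u \<in> energy_space c" "g \<in> span (range delta)" for u g
  proof -
    have "g \<in> energy_space c" using that(2) span_delta_subset_energy_space by blast
    then show ?thesis unfolding energy_def dist_norm using that(1)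
      by (simp add: energy_form_eq_inner subspace_diff[OF subspace_energy_space] grad_diff
          power2_norm_eq_inner[symmetric] norm_minus_commute)
  qed
  have "(\<forall>e>0. \<exists>g\<in>span (range delta). energy c (u - g) < e) \<longleftrightarrow>
      (\<forall>e>0. \<exists>g\<in>span (range delta). dist (grad c g) (grad c u) < e)" (is "?L \<longleftrightarrow> ?R")
    if u: "u \<in> energy_space c"
  proof
    assume L: ?L
    show ?R
    proof (intro allI impI)
      fix e :: real assume e: "0 < e"
      then obtain g where g: "g \<in> span (range delta)" "energy c (u - g) < e\<^sup>2"
        using L[rule_format, of "e\<^sup>2"] by auto
      then have "dist (grad c g) (grad c u) < e"
        using e unfolding energy[OF u g(1)] by (simp add: power2_less_imp_less)
      with g(1) show "\<exists>g\<in>span (range delta). dist (grad c g) (grad c u) < e" by blast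
    qed
  next
    assume R: ?R
    show ?L
    proof (intro allI impI)
      fix e :: real assume e: "0 < e"
      then obtain g where g: "g \<in> span (range delta)" "dist (grad c g) (grad c u) < sqrt e"
        using R[rule_format, of "sqrt e"] by auto
      have "energy c (u - g) < (sqrt e)\<^sup>2"
        unfolding energy[OF u g(1)] using g(2) by (intro power_strict_mono) auto
      then show "\<exists>g\<in>span (range delta). energy c (u - g) < e" using g(1) e by auto
    qed
  qed
  then show ?thesis unfolding Fin_def closure_approachable by auto
qed

lemma grad_Fin: "grad c ` Fin c = closure (grad c ` span (range delta))"
proof -
  have "closure (grad c ` span (range delta)) \<subseteq> grad c ` energy_space c"
    using span_delta_subset_energy_space by (intro closure_minimal closed_grad_energy_space image_mono)
  then show ?thesis using mem_Fin_iff by blast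
qed

lemma subspace_Fin: "subspace (Fin c)"
proof -
  have "subspace (closure (grad c ` span (range delta)))"
    by (intro subspace_closure subspace_grad_image subspace_span span_delta_subset_energy_space)
  moreover have "grad c 0 = 0"
    using grad_scaleR[of 0 0] subspace_0[OF subspace_energy_space] by simp
  ultimately show ?thesis
    using subspace_energy_space unfolding subspace_def
    by (simp add: mem_Fin_iff grad_add grad_scaleR)
qed

lemma Fin_subset: "Fin c \<subseteq> energy_space c" by (auto simp: Fin_def)

lemma span_delta_subset_Fin: "span (range delta) \<subseteq> Fin c"
  using span_delta_subset_energy_space closure_subset unfolding mem_Fin_iff subset_iff by blast

text \<open>
  On \<^const>\<open>Fin\<close>, the projected kernel represents the same evaluation functional as the kernel itself,
  since \<open>v\<^sub>x - f\<^sub>x\<close> is orthogonal to \<^const>\<open>Fin\<close>. So \<open>f\<^sub>x\<close> can be found as the representer of evaluation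
  on \<^const>\<open>Fin\<close>, and the same lemma serves for both.
\<close>
lemma proj_Fin_energy_kernel:
  "proj_Fin c (energy_kernel c a x) \<in> Fin c"
  "g \<in> Fin c \<Longrightarrow> energy_form c (proj_Fin c (energy_kernel c a x)) g = increment g x a"
proof -
  let ?v = "energy_kernel c a x"
  obtain C where C: "\<forall>u\<in>energy_space c. \<bar>increment u x a\<bar> \<le> C * norm (grad c u)"
    using increment_bounded by blast
  have "\<exists>!v. v \<in> energy_space c \<and> (\<forall>u\<in>energy_space c. energy_form c v u = increment u x a)"
    by (rule ex1_energy_representer[OF subspace_energy_space order_refl closed_grad_energy_space])
      (use C in \<open>auto simp: increment_add increment_scaleR\<close>)
  from theI'[OF this] have v: "?v \<in> energy_space c"
      "\<And>u. u \<in> energy_space c \<Longrightarrow> energy_form c ?v u = increment u x a"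
    unfolding energy_kernel_def by auto
  have form: "energy_form c (?v - f) g = 0 \<longleftrightarrow> energy_form c f g = increment g x a"
    if "f \<in> Fin c" "g \<in> Fin c" for f g
  proof -
    have "energy_form c (?v - f) g = energy_form c ?v g - energy_form c f g"
      using that v(1) Fin_subset
      by (simp add: subset_iff energy_form_eq_inner subspace_diff[OF subspace_energy_space] grad_diff inner_diff_left)
    then show ?thesis using v(2)[of g] that Fin_subset by auto
  qed
  have "\<exists>!f. f \<in> Fin c \<and> (\<forall>g\<in>Fin c. energy_form c f g = increment g x a)"
    by (rule ex1_energy_representer[OF subspace_Fin Fin_subset])
      (use C Fin_subset in \<open>auto simp: increment_add increment_scaleR grad_Fin\<close>)
  moreover have "(f \<in> Fin c \<and> (\<forall>g\<in>Fin c. energy_form c f g = increment g x a)) \<longleftrightarrow>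
      (f \<in> Fin c \<and> (\<forall>g\<in>Fin c. energy_form c (?v - f) g = 0))" for f
    using form by blast
  ultimately have "\<exists>!f. f \<in> Fin c \<and> (\<forall>g\<in>Fin c. energy_form c (?v - f) g = 0)" by simp
  from theI'[OF this] have f: "proj_Fin c ?v \<in> Fin c"
      "\<forall>g\<in>Fin c. energy_form c (?v - proj_Fin c ?v) g = 0"
    unfolding proj_Fin_def by auto
  then show "proj_Fin c ?v \<in> Fin c" by simp
  show "g \<in> Fin c \<Longrightarrow> energy_form c (proj_Fin c ?v) g = increment g x a"
    using f form by blast
qed

text \<open>
  Summation by parts against a point mass: only the pairs that contain \<open>z\<close> contribute, and each of
  the two orders yields the full Laplacian, which cancels the factor \<open>1/2\<close>.
\<close>
lemma energy_form_delta:
  assumes "u \<in> energy_space c"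
  shows "energy_form c u (delta z) = laplacian_modconst c u z"
proof -
  let ?N = "{y. 0 < c z y}"
  define f where "f y = c z y * increment u z y" for y
  have f0: "f y = 0" if "y \<notin> ?N" for y
    using that nonneg[of z y] by (auto simp: f_def)
  have delta: "increment (delta z) x y = indicator {z} x - indicator {z} y" for x y
    by transfer simp
  have anti: "increment u x y = - increment u y x" for x y by transfer simp
  have zero: "increment u x x = 0" for x by transfer simp
  have split: "c (fst p) (snd p) * increment u (fst p) (snd p) * increment (delta z) (fst p) (snd p)
     = (if fst p = z then f (snd p) else 0) + (if snd p = z then f (fst p) else 0)" for p
  proof -
    obtain x y where p: "p = (x, y)" by fastforce
    consider "x = z" "y = z" | "x = z" "y \<noteq> z" | "x \<noteq> z" "y = z" | "x \<noteq> z" "y \<noteq> z" by blast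
    then show ?thesis
    proof cases
      case 3
      have "c x z * increment u x z * - 1 = c z x * increment u z x"
        using sym[of x z] anti[of x z] by simp
      then show ?thesis using 3 by (simp add: p f_def delta)
    qed (simp_all add: p f_def delta zero)
  qed
  have "((\<lambda>p. if fst p = z then f (snd p) else 0) has_sum sum f ?N) UNIV"
  proof -
    have "((\<lambda>p. if fst p = z then f (snd p) else 0) has_sum
        (\<Sum>p\<in>Pair z ` ?N. if fst p = z then f (snd p) else 0)) UNIV"
      using locally_finite f0 by (intro has_sum_finite_neutralI) (auto intro!: f0)
    then show ?thesis by (subst (asm) sum.reindex) (auto simp: inj_on_def)
  qed
  moreover have "((\<lambda>p. if snd p = z then f (fst p) else 0) has_sum sum f ?N) UNIV"
  proof -
    have "((\<lambda>p. if snd p = z then f (fst p) else 0) has_sum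
        (\<Sum>p\<in>(\<lambda>y. (y, z)) ` ?N. if snd p = z then f (fst p) else 0)) UNIV"
      using locally_finite f0 by (intro has_sum_finite_neutralI) (auto intro!: f0)
    then show ?thesis by (subst (asm) sum.reindex) (auto simp: inj_on_def)
  qed
  ultimately have "((\<lambda>p. c (fst p) (snd p) * increment u (fst p) (snd p) * increment (delta z) (fst p) (snd p))
      has_sum (sum f ?N + sum f ?N)) UNIV"
    unfolding split by (rule has_sum_add)
  moreover have "energy_form c u (delta z) =
      (\<Sum>\<^sub>\<infinity>p. c (fst p) (snd p) * increment u (fst p) (snd p) * increment (delta z) (fst p) (snd p)) / 2"
    by transfer (simp add: case_prod_unfold)
  moreover have "laplacian_modconst c u z = sum f ?N"
    unfolding f_def by transfer (simp add: laplacian_def)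
  ultimately show ?thesis by (simp add: infsumI)
qed

end

section \<open>The Laplacian on finitely supported functions\<close>

text \<open>
  The graph of the Laplacian on finitely supported functions, a core of \<^const>\<open>laplacian2\<close>.
\<close>
definition laplacian_core :: "('a \<Rightarrow> 'a \<Rightarrow> real) \<Rightarrow> ('a ell2 \<times> 'a ell2) set"
  where "laplacian_core c = {(u, w). u \<in> span (range delta2) \<and> fun_of w = laplacian c (fun_of u)}"

lemma laplacian2_eq_closure: "laplacian2 c = closure (laplacian_core c)"
  by (simp add: laplacian2_def laplacian_core_def)

lemma laplacian_add: "laplacian c (\<lambda>x. u x + v x) x = laplacian c u x + laplacian c v x"
  unfolding laplacian_def sum.distrib[symmetric] by (intro sum.cong) (simp_all add: algebra_simps)

lemma laplacian_scale: "laplacian c (\<lambda>x. r * u x) x = r * laplacian c u x"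
  unfolding laplacian_def sum_distrib_left by (intro sum.cong) (simp_all add: algebra_simps)

lemma subspace_laplacian_core: "subspace (laplacian_core c)"
  unfolding subspace_def laplacian_core_def
proof (intro conjI ballI allI)
  have "laplacian c (fun_of 0) = fun_of 0" by (simp add: fun_eq_iff laplacian_def fun_of_zero)
  then show "0 \<in> {(u, w). u \<in> span (range delta2) \<and> fun_of w = laplacian c (fun_of u)}"
    by (simp add: zero_prod_def span_zero)
next
  fix p q
  assume "p \<in> {(u, w). u \<in> span (range delta2) \<and> fun_of w = laplacian c (fun_of u)}"
    and "q \<in> {(u, w). u \<in> span (range delta2) \<and> fun_of w = laplacian c (fun_of u)}"
  then show "p + q \<in> {(u, w). u \<in> span (range delta2) \<and> fun_of w = laplacian c (fun_of u)}"
    by (cases p; cases q) (simp add: span_add plus_ell2.rep_eq laplacian_add fun_eq_iff)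
next
  fix p and r :: real
  assume "p \<in> {(u, w). u \<in> span (range delta2) \<and> fun_of w = laplacian c (fun_of u)}"
  then show "r *\<^sub>R p \<in> {(u, w). u \<in> span (range delta2) \<and> fun_of w = laplacian c (fun_of u)}"
    by (cases p) (simp add: span_scale scaleR_ell2.rep_eq laplacian_scale fun_eq_iff)
qed

context network
begin

text \<open>
  By local finiteness the Laplacian of a point mass has finite support, hence is square-summable;
  the rest is linearity.
\<close>
lemma laplacian_core_total:
  assumes "u \<in> span (range delta2)"
  shows "\<exists>w. (u, w) \<in> laplacian_core c"
  using assms
proof (induction rule: span_induct_alt)
  case base
  show ?case using subspace_0[OF subspace_laplacian_core] by (auto simp: zero_prod_def)
next
  case (step r d v)
  then obtain z w where d: "d = delta2 z" and w: "(v, w) \<in> laplacian_core c" by blast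
  have "laplacian c (indicator {z}) y = 0" if "y \<notin> insert z {y. 0 < c z y}" for y
  proof -
    have "y \<noteq> z" "c y z = 0" using that nonneg[of z y] sym[of y z] by auto
    then show ?thesis unfolding laplacian_def by (intro sum.neutral) (auto simp: indicator_def)
  qed
  then have "{y \<in> UNIV. (laplacian c (indicator {z}) y)\<^sup>2 \<noteq> 0} \<subseteq> insert z {y. 0 < c z y}" by auto
  then have "(\<lambda>y. (laplacian c (indicator {z}) y)\<^sup>2) summable_on UNIV"
    by (intro finite_nonzero_values_imp_summable_on finite_subset[OF _ finite.insertI[OF locally_finite]])
  then have "fun_of (Abs_ell2 (laplacian c (indicator {z}))) = laplacian c (fun_of (delta2 z))"
    by (simp add: Abs_ell2_inverse delta2.rep_eq)
  then have "(delta2 z, Abs_ell2 (laplacian c (indicator {z}))) \<in> laplacian_core c"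
    unfolding laplacian_core_def by (simp add: span_base)
  from subspace_add[OF subspace_laplacian_core subspace_scale[OF subspace_laplacian_core this] w]
  show ?case unfolding d by auto
qed

lemma mod_const_mem_span: "u \<in> span (range delta2) \<Longrightarrow> mod_const u \<in> span (range delta)"
  unfolding span_delta_eq by blast

lemma mod_const_mem_energy_space: "u \<in> span (range delta2) \<Longrightarrow> mod_const u \<in> energy_space c"
  using mod_const_mem_span span_delta_subset_energy_space by blast

text \<open>
  Summation by parts, extended from point masses by linearity in \<open>h\<close>.
\<close>
lemma energy_form_eq_inner_laplacian:
  assumes gw: "(g, w) \<in> laplacian_core c" and h: "h \<in> span (range delta2)"
  shows "energy_form c (mod_const g) (mod_const h) = inner w h"
proof -
  have g: "mod_const g \<in> energy_space c"
    using gw mod_const_mem_energy_space by (auto simp: laplacian_core_def)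
  have "h \<in> span (range delta2) \<and> energy_form c (mod_const g) (mod_const h) = inner w h"
    using h
  proof (induction rule: span_induct_alt)
    case base
    have 0: "mod_const 0 = (0 :: 'a modconst)" by (rule linear_0[OF linear_mod_const])
    have "grad c 0 = 0"
      using grad_scaleR[of 0 0] subspace_0[OF subspace_energy_space] by simp
    then show ?case
      using g subspace_0[OF subspace_energy_space] by (simp add: 0 energy_form_eq_inner span_zero)
  next
    case (step r d v)
    then obtain z where d: "d = delta2 z" by blast
    have v: "mod_const v \<in> energy_space c" using step by (simp add: mod_const_mem_energy_space)
    have "laplacian_modconst c (mod_const g) z = laplacian c (fun_of g) z"
      by (simp add: mod_const_def laplacian_modconst.abs_eq)
    also have "\<dots> = inner w (delta2 z)" using gw by (simp add: laplacian_core_def inner_delta2)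
    finally have "inner (grad c (mod_const g)) (grad c (delta z)) = inner w (delta2 z)"
      using g delta_mem_energy_space by (simp add: energy_form_eq_inner[symmetric] energy_form_delta)
    moreover have "inner (grad c (mod_const g)) (grad c (mod_const v)) = inner w v"
      using step g v by (simp add: energy_form_eq_inner[symmetric])
    moreover have "mod_const (r *\<^sub>R d + v) = r *\<^sub>R delta z + mod_const v"
      by (simp add: d linear_add[OF linear_mod_const] linear_scale[OF linear_mod_const] mod_const_delta2)
    ultimately have "energy_form c (mod_const g) (mod_const (r *\<^sub>R d + v)) = inner w (r *\<^sub>R d + v)"
      using g v delta_mem_energy_space[of z]
      by (simp add: d energy_form_eq_inner subspace_add[OF subspace_energy_space]
          subspace_scale[OF subspace_energy_space] grad_add grad_scaleR inner_simps)
    moreover have "r *\<^sub>R d + v \<in> span (range delta2)"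
      using step d by (simp add: span_add span_scale span_base)
    ultimately show ?case by blast
  qed
  then show ?thesis by blast
qed

lemma energy_nonneg: "u \<in> energy_space c \<Longrightarrow> 0 \<le> energy c u"
  by (simp add: energy_def energy_form_eq_inner)

section \<open>A variational formula for the wired resistance\<close>

text \<open>
  The vector \<open>f = f\<^sub>x - f\<^sub>y\<close> satisfies \<open>\<E>(f, g) = g(x) - g(y) = \<langle>\<delta>\<^sub>x - \<delta>\<^sub>y, g\<rangle>\<close>, and \<open>\<langle>\<Delta> g, g\<rangle> = \<E>(g)\<close>, so
  the left-hand side is \<open>2 \<E>(f, g) - \<E>(g)\<close>; completing the square isolates \<open>\<E>(f)\<close>, which is the
  wired resistance.
\<close>
lemma wired_resistance_completed_square:
  fixes x y :: 'a
  obtains f where "f \<in> Fin c"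
    and "\<And>g w. (g, w) \<in> laplacian_core c \<Longrightarrow>
      2 * inner (delta2 x - delta2 y) g - inner w g = wired_resistance c a x y - energy c (f - mod_const g)"
proof
  let ?f = "\<lambda>x. proj_Fin c (energy_kernel c a x)"
  define f where "f = ?f x - ?f y"
  have fF: "?f z \<in> Fin c" for z by (rule proj_Fin_energy_kernel)
  then have fE: "?f z \<in> energy_space c" for z using Fin_subset by blast
  show f: "f \<in> Fin c" unfolding f_def using fF by (intro subspace_diff subspace_Fin)
  then have f': "f \<in> energy_space c" using Fin_subset by blast
  fix g w assume gw: "(g, w) \<in> laplacian_core c"
  then have g: "g \<in> span (range delta2)" by (simp add: laplacian_core_def)
  then have gF: "mod_const g \<in> Fin c" using mod_const_mem_span span_delta_subset_Fin by blast
  then have gE: "mod_const g \<in> energy_space c" using Fin_subset by blast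
  have "energy_form c f (mod_const g) = increment (mod_const g) x a - increment (mod_const g) y a"
    using proj_Fin_energy_kernel(2)[OF gF, of a] fE gE
    by (simp add: f_def energy_form_eq_inner subspace_diff[OF subspace_energy_space] grad_diff inner_diff_left)
  also have "\<dots> = inner (delta2 x - delta2 y) g"
    by (simp add: increment_mod_const inner_diff_left inner_commute[of "delta2 _"] inner_delta2)
  finally have 1: "inner (grad c f) (grad c (mod_const g)) = inner (delta2 x - delta2 y) g"
    using f' gE by (simp add: energy_form_eq_inner)
  have 2: "inner (grad c (mod_const g)) (grad c (mod_const g)) = inner w g"
    using energy_form_eq_inner_laplacian[OF gw g] gE by (simp add: energy_form_eq_inner)
  have 3: "wired_resistance c a x y = inner (grad c f) (grad c f)"
    using f' by (simp add: wired_resistance_def f_def energy_def energy_form_eq_inner)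
  have "energy c (f - mod_const g) = inner (grad c f - grad c (mod_const g)) (grad c f - grad c (mod_const g))"
    using f' gE by (simp add: energy_def energy_form_eq_inner subspace_diff[OF subspace_energy_space] grad_diff)
  also have "\<dots> = inner (grad c f) (grad c f) - 2 * inner (grad c f) (grad c (mod_const g))
      + inner (grad c (mod_const g)) (grad c (mod_const g))"
    by (simp add: inner_diff_left inner_diff_right inner_commute)
  finally show "2 * inner (delta2 x - delta2 y) g - inner w g = wired_resistance c a x y - energy c (f - mod_const g)"
    unfolding 1 2 3[symmetric] by simp
qed

text \<open>
  Non-negativity and the bound in the next lemma hold on the core because energies are
  non-negative. They are closed conditions on pairs \<open>(g, w)\<close>, so they pass to the closure of the
  graph.
\<close>
lemma inner_laplacian2_nonneg:
  assumes "(g, w) \<in> laplacian2 c"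
  shows "0 \<le> inner w g"
proof -
  have "laplacian_core c \<subseteq> {p. 0 \<le> inner (snd p) (fst p)}"
  proof clarsimp
    fix g w assume gw: "(g, w) \<in> laplacian_core c"
    then have g: "g \<in> span (range delta2)" by (simp add: laplacian_core_def)
    then show "0 \<le> inner w g"
      unfolding energy_form_eq_inner_laplacian[OF gw g, symmetric]
      by (simp add: energy_form_eq_inner mod_const_mem_energy_space)
  qed
  moreover have "closed {p :: 'a ell2 \<times> 'a ell2. 0 \<le> inner (snd p) (fst p)}"
    by (intro closed_Collect_le continuous_intros)
  ultimately have "laplacian2 c \<subseteq> {p. 0 \<le> inner (snd p) (fst p)}"
    unfolding laplacian2_eq_closure by (rule closure_minimal)
  then show ?thesis using assms by auto
qed

lemma dirichlet_le_wired_resistance: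
  assumes "(g, w) \<in> laplacian2 c"
  shows "2 * inner (delta2 x - delta2 y) g - inner w g \<le> wired_resistance c a x y"
proof -
  let ?R = "wired_resistance c a x y"
  obtain f where f: "f \<in> Fin c"
    "\<And>g w. (g, w) \<in> laplacian_core c \<Longrightarrow>
      2 * inner (delta2 x - delta2 y) g - inner w g = ?R - energy c (f - mod_const g)"
    using wired_resistance_completed_square[of x y a] by blast
  have "laplacian_core c \<subseteq> {p. 2 * inner (delta2 x - delta2 y) (fst p) - inner (snd p) (fst p) \<le> ?R}"
  proof clarsimp
    fix g w assume gw: "(g, w) \<in> laplacian_core c"
    then have "mod_const g \<in> energy_space c"
      using mod_const_mem_energy_space by (simp add: laplacian_core_def)
    then have "energy c (f - mod_const g) \<ge> 0"
      using f(1) Fin_subset by (intro energy_nonneg subspace_diff[OF subspace_energy_space]) auto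
    then show "2 * inner (delta2 x - delta2 y) g - inner w g \<le> ?R"
      unfolding f(2)[OF gw] by simp
  qed
  moreover have "closed {p :: 'a ell2 \<times> 'a ell2. 2 * inner (delta2 x - delta2 y) (fst p) - inner (snd p) (fst p) \<le> ?R}"
    by (intro closed_Collect_le continuous_intros)
  ultimately have "laplacian2 c \<subseteq> {p. 2 * inner (delta2 x - delta2 y) (fst p) - inner (snd p) (fst p) \<le> ?R}"
    unfolding laplacian2_eq_closure by (rule closure_minimal)
  then show ?thesis using assms by auto
qed

text \<open>
  The supremum of the Dirichlet functional is attained up to \<open>e\<close> already on the core, because \<open>f\<close>
  lies in \<^const>\<open>Fin\<close>, the energy closure of the finitely supported functions.
\<close>
lemma dirichlet_approx_wired_resistance:
  assumes "0 < e"
  shows "\<exists>(g, w) \<in> laplacian2 c. wired_resistance c a x y - e < 2 * inner (delta2 x - delta2 y) g - inner w g"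
proof -
  let ?R = "wired_resistance c a x y"
  obtain f where f: "f \<in> Fin c"
    "\<And>g w. (g, w) \<in> laplacian_core c \<Longrightarrow>
      2 * inner (delta2 x - delta2 y) g - inner w g = ?R - energy c (f - mod_const g)"
    using wired_resistance_completed_square[of x y a] by blast
  obtain h where h: "h \<in> span (range delta)" "energy c (f - h) < e"
    using f(1) assms unfolding Fin_def by blast
  then obtain g where g: "g \<in> span (range delta2)" "h = mod_const g"
    unfolding span_delta_eq by blast
  obtain w where gw: "(g, w) \<in> laplacian_core c" using laplacian_core_total[OF g(1)] by blast
  have "?R - e < 2 * inner (delta2 x - delta2 y) g - inner w g"
    using f(2)[OF gw] h(2) g(2) by simp
  moreover have "(g, w) \<in> laplacian2 c"
    using gw closure_subset unfolding laplacian2_eq_closure by blast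
  ultimately show ?thesis by blast
qed

end

section \<open>Scalar measures of a projection-valued measure\<close>
locale pvm =
  fixes P :: "real set \<Rightarrow> 'h::{real_inner, complete_space} \<Rightarrow> 'h"
  assumes pvm: "projection_valued_measure P"
begin

abbreviation \<mu> :: "'h \<Rightarrow> real measure"
  where "\<mu> \<equiv> scalar_measure P"

lemma orthogonal_projection_P: "A \<in> sets borel \<Longrightarrow> orthogonal_projection (P A)"
  using pvm unfolding projection_valued_measure_def by blast

lemma linear_P: "A \<in> sets borel \<Longrightarrow> linear (P A)"
  using orthogonal_projection_P unfolding orthogonal_projection_def
  by (blast intro: bounded_linear.linear)

lemma P_add: "A \<in> sets borel \<Longrightarrow> P A (u + v) = P A u + P A v"
  by (rule linear_add[OF linear_P])

lemma P_diff: "A \<in> sets borel \<Longrightarrow> P A (u - v) = P A u - P A v"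
  by (rule linear_diff[OF linear_P])

lemma P_scaleR: "A \<in> sets borel \<Longrightarrow> P A (r *\<^sub>R u) = r *\<^sub>R P A u"
  by (rule linear_scale[OF linear_P])

lemma P_self_adjoint: "A \<in> sets borel \<Longrightarrow> inner (P A u) v = inner u (P A v)"
  using orthogonal_projection_P unfolding orthogonal_projection_def by blast

lemma P_idem: "A \<in> sets borel \<Longrightarrow> P A (P A u) = P A u"
  using orthogonal_projection_P unfolding orthogonal_projection_def by (metis comp_apply)

lemma P_Int: "A \<in> sets borel \<Longrightarrow> B \<in> sets borel \<Longrightarrow> P A (P B u) = P (A \<inter> B) u"
  using pvm unfolding projection_valued_measure_def by (metis comp_apply)

lemma P_empty: "P {} u = 0"
  using pvm unfolding projection_valued_measure_def by metis

lemma P_UNIV: "P UNIV u = u"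
  using pvm unfolding projection_valued_measure_def by (metis id_apply)

lemma P_sums: "range A \<subseteq> sets borel \<Longrightarrow> disjoint_family A \<Longrightarrow> (\<lambda>n. P (A n) u) sums P (\<Union>n. A n) u"
  using pvm unfolding projection_valued_measure_def by blast

lemma inner_P_P: "A \<in> sets borel \<Longrightarrow> inner (P A u) (P A v) = inner (P A u) v"
  by (simp add: P_self_adjoint P_idem)

lemma norm_P_le:
  assumes "A \<in> sets borel"
  shows "norm (P A u) \<le> norm u"
proof (cases "P A u = 0")
  case False
  have "norm (P A u) * norm (P A u) \<le> norm (P A u) * norm u"
    using norm_cauchy_schwarz[of "P A u" u] inner_P_P[OF assms, of u u]
    by (simp add: power2_norm_eq_inner power2_eq_square[symmetric])
  then show ?thesis using False by simp
qed simp

lemma emeasure_\<mu>: "A \<in> sets borel \<Longrightarrow> emeasure (\<mu> u) A = ennreal ((norm (P A u))\<^sup>2)"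
  by (rule emeasure_scalar_measure[OF pvm])

lemma finite_measure_\<mu>: "finite_measure (\<mu> u)"
  by (rule finite_measureI) (simp add: emeasure_\<mu>)

lemma measure_\<mu>: "A \<in> sets borel \<Longrightarrow> measure (\<mu> u) A = (norm (P A u))\<^sup>2"
  by (simp add: measure_def emeasure_\<mu>)

lemma \<mu>_eqI: "(\<And>A. A \<in> sets borel \<Longrightarrow> norm (P A u) = norm (P A v)) \<Longrightarrow> \<mu> u = \<mu> v"
  by (rule measure_eqI) (auto simp: emeasure_\<mu>)

lemma \<mu>_uminus: "\<mu> (- u) = \<mu> u"
  by (rule \<mu>_eqI) (simp add: linear_neg[OF linear_P])

text \<open>
  Projecting the vector restricts its scalar measure. This converts splittings of the real line
  into orthogonal decompositions of vectors.
\<close>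
lemma \<mu>_P:
  assumes "A \<in> sets borel"
  shows "\<mu> (P A u) = density (\<mu> u) (\<lambda>t. ennreal (indicator A t))"
proof (rule measure_eqI)
  fix B assume "B \<in> sets (\<mu> (P A u))"
  then have B: "B \<in> sets borel" by simp
  have "emeasure (density (\<mu> u) (indicator A)) B = emeasure (\<mu> u) (B \<inter> A)"
    using assms B by (subst emeasure_density)
      (auto simp: indicator_inter_arith[symmetric] nn_integral_indicator mult.commute Int_commute intro!: nn_integral_cong)
  then show "emeasure (\<mu> (P A u)) B = emeasure (density (\<mu> u) (\<lambda>t. ennreal (indicator A t))) B"
    using assms B by (simp add: emeasure_\<mu> P_Int ennreal_indicator Int_commute)
qed simp

lemma AE_\<mu>_P:
  assumes "A \<in> sets borel" "P A u = u"
  shows "AE t in \<mu> u. t \<in> A"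
proof -
  have "P (- A) u = P (- A) (P A u)" by (simp only: assms(2))
  also have "\<dots> = 0" using assms(1) by (subst P_Int) (auto simp: P_empty)
  finally show ?thesis
    using assms(1) by (intro AE_I[of _ _ "- A"]) (auto simp: emeasure_\<mu>)
qed

lemma integral_\<mu>_scaleR:
  fixes f :: "real \<Rightarrow> real"
  assumes "f \<in> borel_measurable borel"
  shows "(\<integral>t. f t \<partial>\<mu> (r *\<^sub>R u)) = r\<^sup>2 * (\<integral>t. f t \<partial>\<mu> u)"
proof -
  have "\<mu> (r *\<^sub>R u) = density (\<mu> u) (\<lambda>_. ennreal (r\<^sup>2))"
    by (rule measure_eqI)
      (auto simp: emeasure_density_const emeasure_\<mu> P_scaleR power_mult_distrib ennreal_mult[symmetric])
  then show ?thesis using assms by (simp add: integral_density)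
qed

lemma integrable_\<mu>_bounded:
  fixes f :: "real \<Rightarrow> real"
  assumes "A \<in> sets borel" "P A u = u" "f \<in> borel_measurable borel" "\<And>t. t \<in> A \<Longrightarrow> \<bar>f t\<bar> \<le> M"
  shows "integrable (\<mu> u) f"
proof -
  interpret finite_measure "\<mu> u" by (rule finite_measure_\<mu>)
  show ?thesis
    using AE_\<mu>_P[OF assms(1,2)] assms(3,4) by (intro integrable_const_bound[where B = M]) auto
qed

lemma integrable_\<mu>_split:
  fixes f :: "real \<Rightarrow> real"
  assumes A: "A \<in> sets borel" and f: "f \<in> borel_measurable borel"
  shows "integrable (\<mu> u) f \<longleftrightarrow> integrable (\<mu> (P A u)) f \<and> integrable (\<mu> (P (- A) u)) f"
proof -
  have *: "integrable (\<mu> (P B u)) f \<longleftrightarrow> integrable (\<mu> u) (\<lambda>t. indicator B t * f t)" if "B \<in> sets borel" for B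
    using that f by (simp add: \<mu>_P integrable_density)
  have "(\<lambda>t. indicator A t * f t + indicator (- A) t * f t) = f"
    by (auto simp: indicator_def)
  then have "integrable (\<mu> u) f" if "integrable (\<mu> u) (\<lambda>t. indicator A t * f t)"
    "integrable (\<mu> u) (\<lambda>t. indicator (- A) t * f t)"
    using Bochner_Integration.integrable_add[OF that] by simp
  moreover have "integrable (\<mu> u) (\<lambda>t. indicator B t * f t)" if "integrable (\<mu> u) f" "B \<in> sets borel" for B
    using integrable_mult_indicator[of B "\<mu> u" f] that by simp
  ultimately show ?thesis using A by (auto simp: *)
qed

lemma integral_\<mu>_split:
  fixes f :: "real \<Rightarrow> real"
  assumes A: "A \<in> sets borel" and f: "integrable (\<mu> u) f"
  shows "(\<integral>t. f t \<partial>\<mu> u) = (\<integral>t. f t \<partial>\<mu> (P A u)) + (\<integral>t. f t \<partial>\<mu> (P (- A) u))"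
proof -
  have m: "f \<in> borel_measurable borel" using borel_measurable_integrable[OF f] by simp
  have *: "(\<integral>t. f t \<partial>\<mu> (P B u)) = (\<integral>t. indicator B t * f t \<partial>\<mu> u)" if "B \<in> sets borel" for B
    using that m by (simp add: \<mu>_P integral_density)
  have "integrable (\<mu> u) (\<lambda>t. indicator B t * f t)" if "B \<in> sets borel" for B
    using integrable_mult_indicator[of B "\<mu> u" f] that f by simp
  then have "(\<integral>t. indicator A t * f t + indicator (- A) t * f t \<partial>\<mu> u)
      = (\<integral>t. indicator A t * f t \<partial>\<mu> u) + (\<integral>t. indicator (- A) t * f t \<partial>\<mu> u)"
    using A by (intro Bochner_Integration.integral_add) auto
  moreover have "(\<lambda>t. indicator A t * f t + indicator (- A) t * f t) = f"
    by (auto simp: indicator_def)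
  ultimately show ?thesis using A by (simp add: *)
qed

lemma integrable_id_\<mu>:
  assumes "u \<in> spectral_domain P"
  shows "integrable (\<mu> u) (\<lambda>t. t)"
proof -
  interpret finite_measure "\<mu> u" by (rule finite_measure_\<mu>)
  have int: "integrable (\<mu> u) (\<lambda>t. 1 + t\<^sup>2)"
    using assms by (simp add: spectral_domain_def)
  have bound: "norm t \<le> norm (1 + t\<^sup>2)" for t :: real
  proof -
    have "0 \<le> (\<bar>t\<bar> - 1)\<^sup>2 + \<bar>t\<bar>\<^sup>2" by simp
    then have "\<bar>t\<bar> \<le> 1 + t\<^sup>2" by (simp add: power2_diff)
    then show ?thesis by simp
  qed
  show ?thesis
    by (rule Bochner_Integration.integrable_bound[OF int _ AE_I2]) (use bound in simp_all)
qed

lemma spectral_form_self: "spectral_form P u u = (\<integral>t. t \<partial>\<mu> u)"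
  using integral_\<mu>_scaleR[of "\<lambda>t. t" 2 u] integral_\<mu>_scaleR[of "\<lambda>t. t" 0 u]
  by (simp add: spectral_form_def scaleR_2)

section \<open>Vectors with bounded spectral support\<close>

text \<open>
  For vectors with disjoint spectral supports, \<open>u + v\<close> and \<open>u - v\<close> have the same scalar measure by
  Pythagoras, so the polarised integral vanishes.
\<close>
lemma spectral_form_orthogonal:
  assumes "A \<in> sets borel" "B \<in> sets borel" "A \<inter> B = {}" "P A u = u" "P B v = v"
  shows "spectral_form P u v = 0"
proof -
  have "norm (P C (u + v)) = norm (P C (u - v))" if C: "C \<in> sets borel" for C
  proof -
    have "inner (P C u) (P C v) = inner (P C (P A u)) (P B v)"
      using C by (simp add: inner_P_P assms)
    also have "\<dots> = inner (P B (P (C \<inter> A) u)) v"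
      using C assms(1) by (simp only: P_Int P_self_adjoint[OF assms(2)])
    also have "B \<inter> (C \<inter> A) = {}" using assms(3) by blast
    then have "P B (P (C \<inter> A) u) = 0" using C assms(1,2) by (simp add: P_Int P_empty)
    finally have "inner (P C u) (P C v) = 0" by simp
    then have "(norm (P C (u + v)))\<^sup>2 = (norm (P C (u - v)))\<^sup>2"
      using C by (simp add: power2_norm_eq_inner P_add P_diff inner_simps inner_commute)
    then show ?thesis by simp
  qed
  then have "\<mu> (u + v) = \<mu> (u - v)" by (rule \<mu>_eqI)
  then show ?thesis by (simp add: spectral_form_def)
qed

lemma spectral_domain_bounded:
  assumes "A \<in> sets borel" "A \<subseteq> {- M..M}" "P A u = u"
  shows "u \<in> spectral_domain P"
  unfolding spectral_domain_def
proof (intro CollectI integrable_\<mu>_bounded[OF assms(1,3)])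
  fix t assume "t \<in> A"
  then have "t \<in> {- M..M}" using assms(2) by blast
  then have "\<bar>t\<bar> \<le> M" by auto
  then show "\<bar>t\<^sup>2\<bar> \<le> M\<^sup>2" using power_mono[of "\<bar>t\<bar>" M 2] by simp
qed simp

lemma integral_\<mu>_le:
  assumes "A \<in> sets borel" "A \<subseteq> {L..M}" "P A u = u"
  shows "(\<integral>t. t \<partial>\<mu> u) \<le> M * (norm u)\<^sup>2"
proof -
  interpret finite_measure "\<mu> u" by (rule finite_measure_\<mu>)
  have "integrable (\<mu> u) (\<lambda>t. t)"
  proof (rule integrable_\<mu>_bounded[OF assms(1,3)])
    fix t assume "t \<in> A"
    then have "t \<in> {L..M}" using assms(2) by blast
    then show "\<bar>t\<bar> \<le> max \<bar>L\<bar> \<bar>M\<bar>" by auto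
  qed simp
  moreover have "AE t in \<mu> u. t \<le> M"
    using AE_\<mu>_P[OF assms(1,3)] by (rule eventually_mono) (use assms(2) in force)
  ultimately have "(\<integral>t. t \<partial>\<mu> u) \<le> (\<integral>t. M \<partial>\<mu> u)"
    by (intro integral_mono_AE) auto
  then show ?thesis by (simp add: measure_\<mu> P_UNIV mult.commute)
qed

definition level :: "real set \<Rightarrow> nat \<Rightarrow> int \<Rightarrow> real set"
  where "level A n j = A \<inter> {t. \<lfloor>real n * t\<rfloor> = j}"

lemma level_borel: "A \<in> sets borel \<Longrightarrow> level A n j \<in> sets borel"
proof -
  have "{t \<in> space borel. \<lfloor>real n * t\<rfloor> = j} \<in> sets (borel :: real measure)" by measurable
  then show "A \<in> sets borel \<Longrightarrow> level A n j \<in> sets borel"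
    unfolding level_def by simp
qed

text \<open>
  Replacing \<open>t\<close> by \<open>\<lfloor>n t\<rfloor> / n\<close> changes the integral by at most \<open>1/n\<close> times the total mass
  \<open>\<parallel>z\<parallel>\<^sup>2\<close>. The Riemann sum is a finite combination of the quadratic forms \<open>\<parallel>P(B) z\<parallel>\<^sup>2\<close>.
\<close>
lemma integral_\<mu>_riemann:
  assumes A: "A \<in> sets borel" "A \<subseteq> {- M..M}" "P A z = z" and n: "n > 0"
  shows "\<bar>(\<integral>t. t \<partial>\<mu> z) - (\<Sum>j\<in>{\<lfloor>- (real n * M)\<rfloor>..\<lfloor>real n * M\<rfloor>}. real_of_int j / n * (norm (P (level A n j) z))\<^sup>2)\<bar>
    \<le> (norm z)\<^sup>2 / n"
proof -
  interpret finite_measure "\<mu> z" by (rule finite_measure_\<mu>)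
  let ?J = "{\<lfloor>- (real n * M)\<rfloor>..\<lfloor>real n * M\<rfloor>}"
  define s where "s t = (\<Sum>j\<in>?J. real_of_int j / n * indicator (level A n j) t)" for t
  have int_t: "integrable (\<mu> z) (\<lambda>t. t)"
    using integrable_id_\<mu> spectral_domain_bounded A by blast
  have int_ind: "integrable (\<mu> z) (\<lambda>t. indicator (level A n j) t :: real)" for j
    using level_borel[OF A(1)] by (intro integrable_real_indicator) (auto simp: emeasure_\<mu>)
  then have int_s: "integrable (\<mu> z) s" unfolding s_def by auto
  have "(\<integral>t. s t \<partial>\<mu> z) = (\<Sum>j\<in>?J. real_of_int j / n * (norm (P (level A n j) z))\<^sup>2)"
    unfolding s_def using int_ind level_borel[OF A(1)]
    by (subst Bochner_Integration.integral_sum) (auto simp: measure_\<mu>)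
  moreover have "\<bar>t - s t\<bar> \<le> 1 / n" if t: "t \<in> A" for t
  proof -
    let ?k = "\<lfloor>real n * t\<rfloor>"
    have "- M \<le> t" "t \<le> M" using t A(2) by auto
    then have "real n * - M \<le> real n * t" "real n * t \<le> real n * M"
      by (intro mult_left_mono; simp)+
    then have "- (real n * M) \<le> real n * t" "real n * t \<le> real n * M" by simp_all
    then have "?k \<in> ?J" by (auto intro!: floor_mono)
    then have "s t = (\<Sum>j\<in>?J. if j = ?k then real_of_int j / n else 0)"
      unfolding s_def using t by (intro sum.cong) (auto simp: level_def indicator_def)
    then have "s t = real_of_int ?k / n" using \<open>?k \<in> ?J\<close> by simp
    moreover have "\<bar>real n * t - real_of_int ?k\<bar> \<le> 1" by linarith
    then have "\<bar>real n * t - real_of_int ?k\<bar> / n \<le> 1 / n" by (rule divide_right_mono) simp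
    then have "\<bar>(real n * t - real_of_int ?k) / n\<bar> \<le> 1 / n" by simp
    ultimately show ?thesis using n by (simp add: diff_divide_distrib)
  qed
  then have "AE t in \<mu> z. \<bar>t - s t\<bar> \<le> 1 / n" using AE_\<mu>_P[OF A(1,3)] by auto
  then have "(\<integral>t. \<bar>t - s t\<bar> \<partial>\<mu> z) \<le> (\<integral>t. 1 / n \<partial>\<mu> z)"
    using int_t int_s by (intro integral_mono_AE) auto
  moreover have "\<bar>\<integral>t. t - s t \<partial>\<mu> z\<bar> \<le> (\<integral>t. \<bar>t - s t\<bar> \<partial>\<mu> z)" by (rule integral_abs_bound)
  ultimately show ?thesis using int_t int_s by (simp add: measure_\<mu> P_UNIV)
qed

text \<open>
  Polarising the Riemann sums exhibits the spectral form as a limit of functionals that are visibly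
  linear in \<open>v\<close>. That is the point of this lemma: linearity cannot be read off the definition, which
  integrates against the measures of \<open>u + v\<close> and \<open>u - v\<close>.
\<close>
lemma spectral_form_limit:
  assumes A: "A \<in> sets borel" "A \<subseteq> {- M..M}" "P A u = u" "P A v = v"
  shows "(\<lambda>n. \<Sum>j\<in>{\<lfloor>- (real n * M)\<rfloor>..\<lfloor>real n * M\<rfloor>}. real_of_int j / n * inner (P (level A n j) u) v)
    \<longlonglongrightarrow> spectral_form P u v"
proof -
  let ?J = "\<lambda>n. {\<lfloor>- (real n * M)\<rfloor>..\<lfloor>real n * M\<rfloor>}"
  define q where "q n z = (\<Sum>j\<in>?J n. real_of_int j / n * (norm (P (level A n j) z))\<^sup>2)" for n z
  have q: "(\<lambda>n. q n z) \<longlonglongrightarrow> (\<integral>t. t \<partial>\<mu> z)" if z: "P A z = z" for z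
  proof -
    have "(\<lambda>n. (norm z)\<^sup>2 / real n) \<longlonglongrightarrow> 0" by (rule lim_const_over_n)
    moreover have "\<forall>\<^sub>F n in sequentially. norm (q n z - (\<integral>t. t \<partial>\<mu> z)) \<le> (norm z)\<^sup>2 / real n"
      using integral_\<mu>_riemann[OF A(1,2) z]
      by (intro eventually_mono[OF eventually_gt_at_top[of 0]]) (simp add: q_def abs_minus_commute)
    ultimately have "(\<lambda>n. q n z - (\<integral>t. t \<partial>\<mu> z)) \<longlonglongrightarrow> 0" by (rule Lim_null_comparison[rotated])
    then show ?thesis by (simp add: LIM_zero_iff)
  qed
  have "(\<lambda>n. (q n (u + v) - q n (u - v)) / 4) \<longlonglongrightarrow> spectral_form P u v"
    unfolding spectral_form_def using A by (intro tendsto_intros q) (auto simp: P_add P_diff)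
  moreover have "(q n (u + v) - q n (u - v)) / 4
      = (\<Sum>j\<in>?J n. real_of_int j / n * inner (P (level A n j) u) v)" for n
  proof -
    have "(norm (P B (u + v)))\<^sup>2 - (norm (P B (u - v)))\<^sup>2 = 4 * inner (P B u) v" if "B \<in> sets borel" for B
    proof -
      have "(norm (P B (u + v)))\<^sup>2 - (norm (P B (u - v)))\<^sup>2 = 4 * inner (P B u) (P B v)"
        using that by (simp add: power2_norm_eq_inner P_add P_diff inner_simps inner_commute)
      then show ?thesis using that by (simp add: inner_P_P)
    qed
    note * = this[OF level_borel[OF A(1)]]
    have "q n (u + v) - q n (u - v)
        = (\<Sum>j\<in>?J n. real_of_int j / n * ((norm (P (level A n j) (u + v)))\<^sup>2 - (norm (P (level A n j) (u - v)))\<^sup>2))"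
      unfolding q_def by (simp add: sum_subtractf right_diff_distrib)
    also have "\<dots> = 4 * (\<Sum>j\<in>?J n. real_of_int j / n * inner (P (level A n j) u) v)"
      unfolding * sum_distrib_left by (intro sum.cong) auto
    finally show ?thesis by simp
  qed
  ultimately show ?thesis by simp
qed

text \<open>
  Outside \<open>A\<close> the measures of \<open>u + v\<close> and \<open>u - v\<close> both agree with that of \<open>v\<close>, so these contributions
  cancel and only the part of \<open>v\<close> in the range of \<open>P A\<close> remains.
\<close>
lemma spectral_form_localize:
  assumes A: "A \<in> sets borel" "A \<subseteq> {- M..M}" "P A u = u" and v: "v \<in> spectral_domain P"
  shows "spectral_form P u v = spectral_form P u (P A v)"
proof -
  have "P (- A) (P A u) = 0" using A(1) by (simp add: P_Int P_empty)
  then have c: "P (- A) u = 0" using A(3) by simp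
  have mA: "- A \<in> sets borel" using A(1) by auto
  have d: "P (- A) v \<in> spectral_domain P"
    using v A(1) integrable_\<mu>_split[of A "\<lambda>t. t\<^sup>2" v] by (simp add: spectral_domain_def)
  have dom: "z \<in> spectral_domain P" if "P (- A) z = P (- A) v \<or> P (- A) z = - P (- A) v" for z
  proof -
    have "\<mu> (P (- A) z) = \<mu> (P (- A) v)" using that \<mu>_uminus by auto
    moreover have "P A z \<in> spectral_domain P"
      using A by (intro spectral_domain_bounded[of A M]) (auto simp: P_idem)
    ultimately show ?thesis
      using d A(1) integrable_\<mu>_split[of A "\<lambda>t. t\<^sup>2" z] by (simp add: spectral_domain_def)
  qed
  have "(\<integral>t. t \<partial>\<mu> (u + v)) = (\<integral>t. t \<partial>\<mu> (u + P A v)) + (\<integral>t. t \<partial>\<mu> (P (- A) v))"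
    using A mA c integral_\<mu>_split[OF A(1) integrable_id_\<mu>[OF dom[of "u + v"]]]
    by (simp add: P_add)
  moreover have "(\<integral>t. t \<partial>\<mu> (u - v)) = (\<integral>t. t \<partial>\<mu> (u - P A v)) + (\<integral>t. t \<partial>\<mu> (P (- A) v))"
    using A mA c integral_\<mu>_split[OF A(1) integrable_id_\<mu>[OF dom[of "u - v"]]]
    by (simp add: P_diff \<mu>_uminus)
  ultimately show ?thesis unfolding spectral_form_def by simp
qed

text \<open>
  The value \<open>T u\<close> of the operator with spectral measure \<open>P\<close>. The functional
  \<open>\<phi>(v) = \<langle>T u, P(A) v\<rangle>\<close> is defined for all \<open>v\<close>, linear as a limit of linear functionals, and
  bounded, so it has a representing vector.
\<close>
lemma spectral_form_representer:
  assumes A: "A \<in> sets borel" "A \<subseteq> {- M..M}" "P A u = u"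
  shows "\<exists>w. \<forall>v\<in>spectral_domain P. inner w v = spectral_form P u v"
proof -
  define \<phi> where "\<phi> v = spectral_form P u (P A v)" for v
  define l where "l n v = (\<Sum>j\<in>{\<lfloor>- (real n * M)\<rfloor>..\<lfloor>real n * M\<rfloor>}. real_of_int j / n * inner (P (level A n j) u) (P A v))" for n v
  have l: "(\<lambda>n. l n v) \<longlonglongrightarrow> \<phi> v" for v
    unfolding \<phi>_def l_def by (intro spectral_form_limit[OF A]) (simp add: P_idem A(1))
  have add: "\<phi> (v + v') = \<phi> v + \<phi> v'" for v v'
  proof (rule LIMSEQ_unique)
    show "(\<lambda>n. l n (v + v')) \<longlonglongrightarrow> \<phi> (v + v')" by (rule l)
    show "(\<lambda>n. l n (v + v')) \<longlonglongrightarrow> \<phi> v + \<phi> v'"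
      using tendsto_add[OF l l, of v v']
      by (simp add: l_def P_add A(1) inner_add_right distrib_left sum.distrib)
  qed
  have scale: "\<phi> (r *\<^sub>R v) = r * \<phi> v" for r v
  proof (rule LIMSEQ_unique)
    show "(\<lambda>n. l n (r *\<^sub>R v)) \<longlonglongrightarrow> \<phi> (r *\<^sub>R v)" by (rule l)
    have "l n (r *\<^sub>R v) = r * l n v" for n
      unfolding l_def sum_distrib_left by (intro sum.cong) (simp_all add: P_scaleR A(1))
    then show "(\<lambda>n. l n (r *\<^sub>R v)) \<longlonglongrightarrow> r * \<phi> v"
      using tendsto_mult_left[OF l, of r v] by simp
  qed
  have "\<bar>\<phi> v\<bar> \<le> (\<bar>M\<bar> * ((norm u)\<^sup>2 + 1)) * norm v" for v
  proof (cases "v = 0")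
    case True
    then show ?thesis using scale[of 0 v] by simp
  next
    case False
    define e where "e = (1 / norm v) *\<^sub>R v"
    have "norm e = 1" and ve: "v = norm v *\<^sub>R e" using False by (simp_all add: e_def)
    let ?e = "P A e"
    have bound: "\<bar>\<integral>t. t \<partial>\<mu> z\<bar> \<le> \<bar>M\<bar> * (norm z)\<^sup>2" if z: "P A z = z" for z
    proof -
      interpret finite_measure "\<mu> z" by (rule finite_measure_\<mu>)
      have "integrable (\<mu> z) (\<lambda>t. t)"
        using integrable_id_\<mu> spectral_domain_bounded A z by blast
      moreover have "\<bar>t\<bar> \<le> \<bar>M\<bar>" if "t \<in> A" for t
      proof -
        have "t \<in> {- M..M}" using that A(2) by blast
        then show ?thesis by auto
      qed
      then have "AE t in \<mu> z. \<bar>t\<bar> \<le> \<bar>M\<bar>" using AE_\<mu>_P[OF A(1) z] by auto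
      ultimately have "(\<integral>t. \<bar>t\<bar> \<partial>\<mu> z) \<le> (\<integral>t. \<bar>M\<bar> \<partial>\<mu> z)" by (intro integral_mono_AE) auto
      then have "\<bar>\<integral>t. t \<partial>\<mu> z\<bar> \<le> (\<integral>t. \<bar>M\<bar> \<partial>\<mu> z)"
        by (rule order_trans[OF integral_abs_bound])
      then show ?thesis by (simp add: measure_\<mu> P_UNIV mult.commute)
    qed
    \<comment> \<open>The estimate from polarisation is quadratic in \<open>v\<close>; on the unit vector \<open>e\<close> it becomes a
        constant, and homogeneity turns that into the linear bound.\<close>
    have "\<bar>\<phi> e\<bar> \<le> (\<bar>M\<bar> * (norm (u + ?e))\<^sup>2 + \<bar>M\<bar> * (norm (u - ?e))\<^sup>2) / 4"
      using bound[of "u + ?e"] bound[of "u - ?e"] A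
      unfolding \<phi>_def spectral_form_def by (simp add: P_add P_diff P_idem)
    also have "\<dots> = \<bar>M\<bar> * ((norm u)\<^sup>2 + (norm ?e)\<^sup>2) / 2"
      by (simp add: power2_norm_eq_inner inner_simps inner_commute algebra_simps)
    also have "\<dots> \<le> \<bar>M\<bar> * ((norm u)\<^sup>2 + 1)"
    proof -
      have "(norm ?e)\<^sup>2 \<le> 1" using norm_P_le[OF A(1), of e] \<open>norm e = 1\<close> by (simp add: power_le_one)
      then have "\<bar>M\<bar> * ((norm u)\<^sup>2 + (norm ?e)\<^sup>2) \<le> \<bar>M\<bar> * ((norm u)\<^sup>2 + 1)"
        by (intro mult_left_mono) auto
      moreover have "0 \<le> \<bar>M\<bar> * ((norm u)\<^sup>2 + (norm ?e)\<^sup>2)" by simp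
      ultimately show ?thesis by linarith
    qed
    finally have "norm v * \<bar>\<phi> e\<bar> \<le> norm v * (\<bar>M\<bar> * ((norm u)\<^sup>2 + 1))"
      by (intro mult_left_mono) auto
    then show ?thesis by (subst ve) (simp add: scale abs_mult mult.commute)
  qed
  then obtain w where "\<forall>v. inner w v = \<phi> v"
    using riesz_on_closed_subspace[of UNIV \<phi> "\<bar>M\<bar> * ((norm u)\<^sup>2 + 1)"] add scale by auto
  then show ?thesis
    using spectral_form_localize[OF A] unfolding \<phi>_def by auto
qed

end

section \<open>The inverse spectral moment as the supremum of the Dirichlet functional\<close>
lemma sum_nn_integral_disjoint_le:
  fixes A :: "nat \<Rightarrow> 'a set"
  assumes "disjoint_family A" "\<And>k. A k \<in> sets M" "f \<in> borel_measurable M"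
  shows "(\<Sum>k<n. \<integral>\<^sup>+ t. f t * indicator (A k) t \<partial>M) \<le> (\<integral>\<^sup>+ t. f t \<partial>M)"
proof -
  have "(\<Sum>k<n. \<integral>\<^sup>+ t. f t * indicator (A k) t \<partial>M) = (\<integral>\<^sup>+ t. (\<Sum>k<n. f t * indicator (A k) t) \<partial>M)"
    using assms by (subst nn_integral_sum) auto
  also have "\<dots> \<le> (\<integral>\<^sup>+ t. f t \<partial>M)"
  proof (rule nn_integral_mono)
    fix t
    show "(\<Sum>k<n. f t * indicator (A k) t) \<le> f t"
    proof (cases "\<exists>k<n. t \<in> A k")
      case True
      then obtain k where k: "k < n" "t \<in> A k" by blast
      have "(\<Sum>k<n. f t * indicator (A k) t) = f t"
        using k by (intro sum_indicator_disjoint_family disjoint_family_on_mono[OF subset_UNIV assms(1)]) auto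
      then show ?thesis by simp
    qed simp
  qed
  finally show ?thesis .
qed

text \<open>
  In what follows \<open>(u, w) \<in> T\<close> means that \<open>u\<close> is in the domain of the operator and \<open>w = T u\<close>. By the
  assumption on \<open>T\<close>, its domain is the whole spectral domain; this is where self-adjointness enters.
\<close>
locale spectral_resolution = pvm P
  for P :: "real set \<Rightarrow> 'h::{real_inner, complete_space} \<Rightarrow> 'h" +
  fixes T :: "('h \<times> 'h) set"
  assumes spectral: "spectral_measure_of T P"
    and subspace_T: "subspace T"
begin

lemma T_iff: "(u, w) \<in> T \<longleftrightarrow> u \<in> spectral_domain P \<and> (\<forall>v\<in>spectral_domain P. inner w v = spectral_form P u v)"
  using spectral unfolding spectral_measure_of_def by blast

lemma inner_T_self: "(u, w) \<in> T \<Longrightarrow> inner w u = (\<integral>t. t \<partial>\<mu> u)"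
  using T_iff spectral_form_self by auto

lemma bounded_part_in_domain:
  assumes "A \<in> sets borel" "A \<subseteq> {- M..M}"
  shows "\<exists>w. (P A \<xi>, w) \<in> T"
  using spectral_form_representer[OF assms P_idem[OF assms(1)]]
    spectral_domain_bounded[OF assms P_idem[OF assms(1)]] T_iff by blast

lemma inner_T_bounded_part_le:
  assumes "A \<in> sets borel" "A \<subseteq> {L..M}" "(P A \<xi>, w) \<in> T"
  shows "inner w (P A \<xi>) \<le> M * (norm (P A \<xi>))\<^sup>2"
  using integral_\<mu>_le[OF assms(1,2) P_idem[OF assms(1)]] inner_T_self[OF assms(3)] by simp

lemma inner_T_orthogonal:
  assumes "A \<in> sets borel" "B \<in> sets borel" "A \<inter> B = {}" "(P A \<xi>, w) \<in> T" "(P B \<xi>, w') \<in> T"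
  shows "inner w (P B \<xi>) = 0"
  using assms spectral_form_orthogonal[OF assms(1-3) P_idem P_idem] by (simp add: T_iff)

text \<open>
  The test vector is \<open>g = h(T) \<xi>\<close>. With \<open>\<mu>\<close> the scalar measure of \<open>\<xi>\<close>, the Dirichlet functional
  at \<open>g\<close> is \<open>\<integral> (2 h - t h\<^sup>2) d\<mu>\<close>, and \<open>2 h - t h\<^sup>2 \<ge> h\<close> because \<open>t h \<le> 1\<close>. The bound \<open>h \<le> 1/t\<close> also confines
  \<open>h\<close> to bounded level sets: \<open>h = d\<close> forces \<open>t \<le> 1/d\<close>, so \<open>g\<close> is in the domain. At \<open>t = 0\<close>, where \<open>1/t\<close>
  is infinite, \<open>h\<close> may be arbitrarily large, so an atom at \<open>0\<close> is excluded as well.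
\<close>
lemma simple_integral_le_of_dirichlet_bound:
  fixes h :: "real \<Rightarrow> ennreal" and E :: real
  assumes bound: "\<And>g w. (g, w) \<in> T \<Longrightarrow> 2 * inner \<xi> g - inner w g \<le> E"
    and simple: "simple_function (\<mu> \<xi>) h"
    and le: "\<And>t. h t \<le> 1 / ennreal t * indicator {0..} t"
    and finite: "\<And>t. h t < top"
  shows "integral\<^sup>S (\<mu> \<xi>) h \<le> ennreal E"
proof -
  define C where "C = range h - {0}"
  have fin: "finite C" using simple by (simp add: C_def simple_function_def)
  define r where "r d = enn2real d" for d
  define A where "A d = h -` {d}" for d
  have A: "A d \<in> sets borel" for d
  proof -
    have "h \<in> borel_measurable (\<mu> \<xi>)" using simple by (rule borel_measurable_simple_function)
    then have "h -` {d} \<inter> space (\<mu> \<xi>) \<in> sets (\<mu> \<xi>)" by (rule measurable_sets) simp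
    then show ?thesis by (simp add: A_def)
  qed
  have r: "ennreal (r d) = d" "r d > 0" if "d \<in> C" for d
    using that finite unfolding C_def r_def
    by (auto simp: enn2real_positive_iff less_top[symmetric] zero_less_iff_neq_zero)
  have sub: "A d \<subseteq> {0..1 / r d}" if d: "d \<in> C" for d
  proof
    fix t assume "t \<in> A d"
    then have ht: "h t = d" by (simp add: A_def)
    have d0: "d \<noteq> 0" using d by (simp add: C_def)
    then have t0: "0 \<le> t" using le[of t] ht by (cases "0 \<le> t") auto
    have "t \<le> 1 / r d"
    proof (cases "t = 0")
      case False
      then have "0 < t" using t0 by simp
      have "ennreal (r d) \<le> 1 / ennreal t" using le[of t] ht t0 r(1)[OF d] by simp
      also have "\<dots> = ennreal (1 / t)" using \<open>0 < t\<close> divide_ennreal[of 1 t] by simp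
      finally have "r d \<le> 1 / t" using \<open>0 < t\<close> by (simp add: ennreal_le_iff)
      then show ?thesis using \<open>0 < t\<close> r(2)[OF d] by (simp add: field_simps)
    qed (use r(2)[OF d] in simp)
    then show "t \<in> {0..1 / r d}" using t0 by simp
  qed
  have "\<exists>w. (P (A d) \<xi>, w) \<in> T" if d: "d \<in> C" for d
    using sub[OF d] r(2)[OF d] by (intro bounded_part_in_domain[OF A, of _ "1 / r d"]) force
  then obtain w where w: "\<And>d. d \<in> C \<Longrightarrow> (P (A d) \<xi>, w d) \<in> T" by metis
  define G where "G = (\<Sum>d\<in>C. r d *\<^sub>R P (A d) \<xi>)"
  define W where "W = (\<Sum>d\<in>C. r d *\<^sub>R w d)"
  have GW: "(G, W) \<in> T"
  proof -
    have "(\<Sum>d\<in>C. r d *\<^sub>R (P (A d) \<xi>, w d)) \<in> T"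
      using w by (intro subspace_sum[OF subspace_T] subspace_scale[OF subspace_T]) auto
    moreover have "(\<Sum>d\<in>C. r d *\<^sub>R (P (A d) \<xi>, w d)) = (G, W)"
      unfolding G_def W_def by (simp add: sum_prod)
    ultimately show ?thesis by simp
  qed
  have "inner \<xi> (P (A d) \<xi>) = (norm (P (A d) \<xi>))\<^sup>2" for d
    using inner_P_P[OF A, of d \<xi> \<xi>] by (simp add: power2_norm_eq_inner inner_commute)
  then have \<xi>G: "inner \<xi> G = (\<Sum>d\<in>C. r d * (norm (P (A d) \<xi>))\<^sup>2)"
    unfolding G_def by (simp add: inner_sum_right)
  have "inner W G = (\<Sum>d\<in>C. \<Sum>e\<in>C. r d * r e * inner (w d) (P (A e) \<xi>))"
  proof -
    have "inner W G = (\<Sum>d\<in>C. r d * inner (w d) G)" unfolding W_def by (simp add: inner_sum_left)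
    then show ?thesis by (simp add: G_def inner_sum_right sum_distrib_left mult.assoc)
  qed
  also have "\<dots> = (\<Sum>d\<in>C. r d * r d * inner (w d) (P (A d) \<xi>))"
  proof (rule sum.cong[OF refl])
    fix d assume d: "d \<in> C"
    have "r d * r e * inner (w d) (P (A e) \<xi>) = 0" if e: "e \<in> C - {d}" for e
    proof -
      have "A d \<inter> A e = {}" using e by (auto simp: A_def)
      then have "inner (w d) (P (A e) \<xi>) = 0"
        using inner_T_orthogonal[OF A A _ w w] d e by blast
      then show ?thesis by simp
    qed
    then show "(\<Sum>e\<in>C. r d * r e * inner (w d) (P (A e) \<xi>)) = r d * r d * inner (w d) (P (A d) \<xi>)"
      unfolding sum.remove[OF fin d] by (simp only: sum.neutral[OF ballI] add_0_right)
  qed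
  also have "\<dots> \<le> (\<Sum>d\<in>C. r d * (norm (P (A d) \<xi>))\<^sup>2)"
  proof (rule sum_mono)
    fix d assume d: "d \<in> C"
    \<comment> \<open>On the level set \<open>A d\<close> the spectral variable is at most \<open>1 / r d\<close>, which absorbs one of the
        two factors \<open>r d\<close>.\<close>
    have "r d * r d * inner (w d) (P (A d) \<xi>) \<le> r d * r d * (1 / r d * (norm (P (A d) \<xi>))\<^sup>2)"
      using inner_T_bounded_part_le[OF A sub[OF d] w[OF d]] by (intro mult_left_mono) auto
    then show "r d * r d * inner (w d) (P (A d) \<xi>) \<le> r d * (norm (P (A d) \<xi>))\<^sup>2"
      using r(2)[OF d] by simp
  qed
  finally have "(\<Sum>d\<in>C. r d * (norm (P (A d) \<xi>))\<^sup>2) \<le> E"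
    using bound[OF GW] \<xi>G by simp
  moreover have "integral\<^sup>S (\<mu> \<xi>) h = ennreal (\<Sum>d\<in>C. r d * (norm (P (A d) \<xi>))\<^sup>2)"
  proof -
    have "integral\<^sup>S (\<mu> \<xi>) h = (\<Sum>d\<in>range h. d * emeasure (\<mu> \<xi>) (A d))"
      by (simp add: simple_integral_def A_def)
    also have "\<dots> = (\<Sum>d\<in>C. d * emeasure (\<mu> \<xi>) (A d))"
      using simple by (intro sum.mono_neutral_right) (auto simp: C_def simple_function_def)
    also have "\<dots> = (\<Sum>d\<in>C. ennreal (r d * (norm (P (A d) \<xi>))\<^sup>2))"
      using r by (intro sum.cong) (simp_all add: emeasure_\<mu>[OF A] ennreal_mult less_imp_le)
    also have "\<dots> = ennreal (\<Sum>d\<in>C. r d * (norm (P (A d) \<xi>))\<^sup>2)"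
      using r(2) by (intro sum_ennreal) (simp add: less_imp_le)
    finally show ?thesis .
  qed
  ultimately show ?thesis by (simp add: ennreal_leI)
qed

text \<open>
  The integral is the supremum of the integrals of the finite-valued simple functions below \<open>1/t\<close>.
\<close>
lemma inverse_moment_le_of_dirichlet_bound:
  assumes "\<And>g w. (g, w) \<in> T \<Longrightarrow> 2 * inner \<xi> g - inner w g \<le> E"
  shows "(\<integral>\<^sup>+ t\<in>{0..}. (1 / ennreal t) \<partial>\<mu> \<xi>) \<le> ennreal E"
  unfolding nn_integral_def_finite
  by (rule SUP_least) (use simple_integral_le_of_dirichlet_bound[OF assms] in \<open>auto simp: le_fun_def\<close>)

text \<open>
  A vector with spectral support in \<open>[-n, -1/n]\<close> has \<open>\<langle>T u, u\<rangle> \<le> -\<parallel>u\<parallel>\<^sup>2/n\<close>, so positivity of \<open>T\<close> makes it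
  zero; these intervals exhaust the negative half-line.
\<close>
lemma null_negative:
  assumes pos: "\<And>g w. (g, w) \<in> T \<Longrightarrow> 0 \<le> inner w g"
  shows "emeasure (\<mu> \<xi>) {..<0} = 0"
proof -
  define A where "A n = {- real (Suc n)..- inverse (real (Suc n))}" for n
  have A: "A n \<in> sets borel" for n by (simp add: A_def)
  have null: "emeasure (\<mu> \<xi>) (A n) = 0" for n
  proof -
    have le1: "inverse (real (Suc n)) \<le> real (Suc n)"
      by (rule order_trans[of _ 1]) (auto simp: inverse_le_1_iff)
    have "A n \<subseteq> {- real (Suc n)..real (Suc n)}"
    proof
      fix t assume "t \<in> A n"
      then have "- real (Suc n) \<le> t" "t \<le> - inverse (real (Suc n))" by (simp_all add: A_def)
      moreover have "0 \<le> inverse (real (Suc n))" by simp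
      ultimately have "t \<le> real (Suc n)" by linarith
      then show "t \<in> {- real (Suc n)..real (Suc n)}" using \<open>- real (Suc n) \<le> t\<close> by simp
    qed
    then obtain w where w: "(P (A n) \<xi>, w) \<in> T"
      using bounded_part_in_domain[OF A] by blast
    have "0 \<le> - inverse (real (Suc n)) * (norm (P (A n) \<xi>))\<^sup>2"
      using inner_T_bounded_part_le[OF A _ w, of "- real (Suc n)" "- inverse (real (Suc n))"] pos[OF w]
      by (simp add: A_def)
    then have "inverse (real (Suc n)) * (norm (P (A n) \<xi>))\<^sup>2 \<le> 0" by simp
    then have "(norm (P (A n) \<xi>))\<^sup>2 = 0"
      by (simp add: mult_le_0_iff del: of_nat_Suc)
    then show ?thesis by (simp add: emeasure_\<mu>[OF A])
  qed
  have "{..<0} \<subseteq> (\<Union>n. A n)"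
  proof
    fix t :: real assume "t \<in> {..<0}"
    then have t: "0 < - t" by simp
    obtain m where m: "- t < real m" using reals_Archimedean2 by blast
    obtain k where k: "inverse (real (Suc k)) < - t" using reals_Archimedean[OF t] by blast
    define n where "n = max m k"
    have "- t \<le> real (Suc n)" using m by (simp add: n_def)
    moreover have "inverse (real (Suc n)) \<le> inverse (real (Suc k))"
      by (rule le_imp_inverse_le) (auto simp: n_def)
    ultimately have "t \<in> A n" using k unfolding A_def atLeastAtMost_iff by linarith
    then show "t \<in> (\<Union>n. A n)" by blast
  qed
  moreover have "(\<Union>n. A n) \<in> null_sets (\<mu> \<xi>)"
    using null A by (intro null_sets_UN) (auto simp: null_sets_def)
  ultimately show ?thesis
    using null_sets_subset[of "\<Union>n. A n" "\<mu> \<xi>" "{..<0}"] by (auto simp: null_sets_def)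
qed

text \<open>
  On a spectral interval \<open>[s, q s]\<close> the arithmetic-geometric mean inequality gives
  \<open>2 \<langle>P \<xi>, P g\<rangle> \<le> \<parallel>P \<xi>\<parallel>\<^sup>2 / s + s \<parallel>P g\<parallel>\<^sup>2\<close>. There \<open>1/s \<le> q/t\<close> and \<open>s \<le> t\<close>, so the two terms are at most \<open>q\<close> times the
  inverse moment of \<open>\<xi>\<close> and the first moment of \<open>g\<close> over the interval. Summing over the geometric
  partition of the positive half-line leaves the factor \<open>q\<close> as the only loss.
\<close>
lemma dirichlet_le_inverse_moment_times:
  assumes pos: "\<And>g w. (g, w) \<in> T \<Longrightarrow> 0 \<le> inner w g"
    and gw: "(g, w) \<in> T" and q: "1 < q"
    and I: "(\<integral>\<^sup>+ t\<in>{0..}. (1 / ennreal t) \<partial>\<mu> \<xi>) = ennreal I" "0 \<le> I"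
  shows "2 * inner \<xi> g \<le> q * I + inner w g"
proof -
  define F where "F t = 1 / ennreal t * indicator {0..} t" for t :: real
  have F_meas: "F \<in> borel_measurable borel" unfolding F_def by measurable
  have IF: "(\<integral>\<^sup>+ t. F t \<partial>\<mu> \<xi>) = ennreal I" using I(1) by (simp add: F_def)
  \<comment> \<open>The interval \<open>[q\<^sup>i, q\<^sup>i\<^sup>+\<^sup>1)\<close> has index \<open>Suc k\<close>, where \<open>k\<close> encodes the integer \<open>i\<close>. Index \<open>0\<close>
      collects the rest of the line, which carries no mass of \<open>\<xi>\<close>: the negative part by
      positivity of \<open>T\<close>, and \<open>0\<close> because \<open>1/t\<close> is infinite there.\<close>
  define A where "A n = (case n of 0 \<Rightarrow> {..0::real} | Suc k \<Rightarrow> {t. 0 < t \<and> \<lfloor>log q t\<rfloor> = int_decode k})" for n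
  have A: "A n \<in> sets borel" for n
  proof (cases n)
    case (Suc k)
    have "{t \<in> space borel. 0 < t \<and> \<lfloor>log q t\<rfloor> = int_decode k} \<in> sets (borel :: real measure)"
      by measurable
    then show ?thesis by (simp add: A_def Suc)
  qed (simp add: A_def)
  have disj: "disjoint_family A"
    unfolding disjoint_family_on_def
  proof (intro ballI impI)
    fix m n :: nat assume "m \<noteq> n"
    then show "A m \<inter> A n = {}"
      by (cases m; cases n) (auto simp: A_def int_decode_eq)
  qed
  have "(\<Union>n. A n) = UNIV"
  proof (intro set_eqI iffI UNIV_I)
    fix t :: real
    have "t \<in> A (if t \<le> 0 then 0 else Suc (int_encode \<lfloor>log q t\<rfloor>))" by (simp add: A_def)
    then show "t \<in> (\<Union>n. A n)" by blast
  qed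
  then have sums: "(\<lambda>n. P (A n) \<xi>) sums \<xi>"
    using P_sums[of A \<xi>] A disj by (simp add: P_UNIV image_subset_iff)
  then have "(\<lambda>n. inner (P (A n) \<xi>) (2 *\<^sub>R g)) sums inner \<xi> (2 *\<^sub>R g)"
    by (rule bounded_linear.sums[OF bounded_linear_inner_left])
  then have sums: "(\<lambda>n. 2 * inner (P (A n) \<xi>) g) sums (2 * inner \<xi> g)" by simp
  have zero: "P (A 0) \<xi> = 0"
  proof -
    have "(\<integral>\<^sup>+ t. \<infinity> * indicator {0} t \<partial>\<mu> \<xi>) \<le> (\<integral>\<^sup>+ t. F t \<partial>\<mu> \<xi>)"
      by (rule nn_integral_mono) (auto simp: F_def indicator_def ennreal_divide_zero)
    then have "\<infinity> * emeasure (\<mu> \<xi>) {0} \<le> ennreal I"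
      unfolding IF by (simp add: nn_integral_cmult_indicator)
    then have "emeasure (\<mu> \<xi>) {0} = 0"
      by (cases "emeasure (\<mu> \<xi>) {0} = 0") (auto simp: ennreal_top_mult top_unique)
    moreover have "emeasure (\<mu> \<xi>) {..0} \<le> emeasure (\<mu> \<xi>) {..<0} + emeasure (\<mu> \<xi>) {0}"
      using emeasure_subadditive[of "{..<0}" "\<mu> \<xi>" "{0}"]
      by (simp only: ivl_disj_un_singleton) simp
    ultimately have "emeasure (\<mu> \<xi>) {..0} = 0" using null_negative[OF pos] by simp
    then show ?thesis by (simp add: emeasure_\<mu> A_def)
  qed
  have g_int: "integrable (\<mu> g) (\<lambda>t. t)" using gw integrable_id_\<mu> T_iff by blast
  have "AE t in \<mu> g. 0 \<le> t"
    using null_negative[OF pos, of g] by (intro AE_I[of _ _ "{..<0}"]) auto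
  then have Ig: "(\<integral>\<^sup>+ t. ennreal t \<partial>\<mu> g) = ennreal (inner w g)"
    using nn_integral_eq_integral[OF g_int] inner_T_self[OF gw] by simp
  define X where "X n = (\<integral>\<^sup>+ t. F t * indicator (A n) t \<partial>\<mu> \<xi>)" for n
  define Y where "Y n = (\<integral>\<^sup>+ t. ennreal t * indicator (A n) t \<partial>\<mu> g)" for n
  have term_le: "\<exists>b\<ge>0. 2 * inner (P (A n) \<xi>) g \<le> b \<and> ennreal b \<le> ennreal q * X n + Y n" for n
  proof (cases n)
    case 0
    then show ?thesis using zero by (intro exI[of _ 0]) simp
  next
    case (Suc k)
    define s where "s = q powr real_of_int (int_decode k)"
    have s: "s > 0" using q by (simp add: s_def)
    have range_A: "0 < t \<and> s \<le> t \<and> t \<le> q * s" if "t \<in> A n" for t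
    proof -
      have t: "0 < t" "\<lfloor>log q t\<rfloor> = int_decode k" using that by (simp_all add: A_def Suc)
      then have "real_of_int (int_decode k) \<le> log q t" "log q t \<le> real_of_int (int_decode k) + 1"
        by linarith+
      then have "s \<le> q powr log q t" "q powr log q t \<le> q powr (real_of_int (int_decode k) + 1)"
        unfolding s_def using q by (auto intro!: powr_mono)
      then show ?thesis using t q by (simp add: s_def powr_add mult.commute)
    qed
    let ?p = "P (A n) \<xi>" and ?r = "P (A n) g"
    define b where "b = (1 / s) * (norm ?p)\<^sup>2 + s * (norm ?r)\<^sup>2"
    have "2 * inner ?p g = 2 * inner ?p ?r" by (simp add: inner_P_P A)
    also have "\<dots> \<le> b"
    proof -
      have "0 \<le> (1 / s) * (norm (?p - s *\<^sub>R ?r))\<^sup>2" using s by simp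
      also have "\<dots> = b - 2 * inner ?p ?r"
        unfolding b_def power2_norm_eq_inner using s
        by (simp add: inner_simps inner_commute field_simps)
      finally show ?thesis by simp
    qed
    finally have 1: "2 * inner ?p g \<le> b" .
    have "ennreal ((1 / s) * (norm ?p)\<^sup>2) = (\<integral>\<^sup>+ t. ennreal (1 / s) * indicator (A n) t \<partial>\<mu> \<xi>)"
      using A s by (subst ennreal_mult) (simp_all add: nn_integral_cmult_indicator emeasure_\<mu>)
    also have "\<dots> \<le> (\<integral>\<^sup>+ t. ennreal q * (F t * indicator (A n) t) \<partial>\<mu> \<xi>)"
    proof (rule nn_integral_mono)
      fix t
      show "ennreal (1 / s) * indicator (A n) t \<le> ennreal q * (F t * indicator (A n) t)"
      proof (cases "t \<in> A n")
        case True
        then have t: "0 < t" "t \<le> q * s" using range_A by auto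
        then have "1 / s \<le> q * (1 / t)" using s by (simp add: field_simps)
        then have "ennreal (1 / s) \<le> ennreal (q * (1 / t))" by (rule ennreal_leI)
        also have "\<dots> = ennreal q * F t"
          using t q divide_ennreal[of 1 t] by (subst ennreal_mult) (simp_all add: F_def)
        finally show ?thesis using True by simp
      qed simp
    qed
    also have "\<dots> = ennreal q * X n"
      unfolding X_def using F_meas A by (intro nn_integral_cmult) simp
    finally have 2: "ennreal ((1 / s) * (norm ?p)\<^sup>2) \<le> ennreal q * X n" .
    have "ennreal (s * (norm ?r)\<^sup>2) = (\<integral>\<^sup>+ t. ennreal s * indicator (A n) t \<partial>\<mu> g)"
      using A s by (subst ennreal_mult) (simp_all add: nn_integral_cmult_indicator emeasure_\<mu>)
    also have "\<dots> \<le> Y n"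
      unfolding Y_def using range_A
      by (intro nn_integral_mono) (auto simp: indicator_def intro!: ennreal_leI)
    finally have 3: "ennreal (s * (norm ?r)\<^sup>2) \<le> Y n" .
    have "ennreal b = ennreal ((1 / s) * (norm ?p)\<^sup>2) + ennreal (s * (norm ?r)\<^sup>2)"
      unfolding b_def using s by (intro ennreal_plus) auto
    then have "ennreal b \<le> ennreal q * X n + Y n" using 2 3 by (simp add: add_mono)
    moreover have "0 \<le> b" unfolding b_def using s by simp
    ultimately show ?thesis using 1 by blast
  qed
  then obtain b where b: "\<And>n. 0 \<le> b n" "\<And>n. 2 * inner (P (A n) \<xi>) g \<le> b n"
    "\<And>n. ennreal (b n) \<le> ennreal q * X n + Y n" by metis
  have nonneg: "0 \<le> q * I + inner w g" using q I(2) pos[OF gw] by simp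
  have "(\<Sum>k<n. 2 * inner (P (A k) \<xi>) g) \<le> q * I + inner w g" for n
  proof -
    have "ennreal (\<Sum>k<n. b k) = (\<Sum>k<n. ennreal (b k))" using b(1) by (simp add: sum_ennreal)
    also have "\<dots> \<le> (\<Sum>k<n. ennreal q * X k + Y k)" by (intro sum_mono b(3))
    also have "\<dots> = ennreal q * (\<Sum>k<n. X k) + (\<Sum>k<n. Y k)"
      by (simp add: sum.distrib sum_distrib_left)
    also have "\<dots> \<le> ennreal q * ennreal I + ennreal (inner w g)"
      unfolding IF[symmetric] Ig[symmetric] X_def Y_def
      using F_meas A by (intro add_mono mult_left_mono sum_nn_integral_disjoint_le[OF disj]) auto
    also have "\<dots> = ennreal (q * I + inner w g)"
      using q I(2) pos[OF gw] by (simp add: ennreal_mult ennreal_plus)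
    finally have "(\<Sum>k<n. b k) \<le> q * I + inner w g" using nonneg by (simp add: ennreal_le_iff)
    then show ?thesis using sum_mono[of "{..<n}", OF b(2)] by (rule order_trans[rotated])
  qed
  then show ?thesis
    using sums unfolding sums_def by (intro LIMSEQ_le_const2) auto
qed

lemma dirichlet_le_inverse_moment:
  assumes pos: "\<And>g w. (g, w) \<in> T \<Longrightarrow> 0 \<le> inner w g"
    and gw: "(g, w) \<in> T"
  shows "ennreal (2 * inner \<xi> g - inner w g) \<le> (\<integral>\<^sup>+ t\<in>{0..}. (1 / ennreal t) \<partial>\<mu> \<xi>)"
proof (cases "(\<integral>\<^sup>+ t\<in>{0..}. (1 / ennreal t) \<partial>\<mu> \<xi>)" rule: ennreal_cases)
  case (real I)
  have "((\<lambda>q. q * I + inner w g) \<longlongrightarrow> 1 * I + inner w g) (at_right 1)"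
    by (intro tendsto_intros)
  moreover have "\<forall>\<^sub>F q in at_right 1. 2 * inner \<xi> g \<le> q * I + inner w g"
    using dirichlet_le_inverse_moment_times[OF pos gw _ real(2) real(1)]
    by (intro eventually_at_right_less[THEN eventually_mono]) 
  ultimately have "2 * inner \<xi> g \<le> 1 * I + inner w g"
    by (rule tendsto_lowerbound) simp
  then show ?thesis unfolding real(2) by (intro ennreal_leI) simp
qed simp

end

section \<open>The wired resistance as a spectral integral\<close>
theorem theorem6p8:
  fixes c :: "'a \<Rightarrow> 'a \<Rightarrow> real" and a x y :: 'a
    and P\<^sub>2 :: "real set \<Rightarrow> 'a ell2 \<Rightarrow> 'a ell2"
  assumes "network c"
    and "infinite (UNIV :: 'a set)"
    and "transient c"
    and "spectral_measure_of (laplacian2 c) P\<^sub>2"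
  shows "ennreal (wired_resistance c a x y) =
    (\<integral>\<^sup>+ t\<in>{0..}. (1 / ennreal t) \<partial>(scalar_measure P\<^sub>2 (delta2 x - delta2 y)))"
proof -
  interpret network c by fact
  interpret spectral_resolution P\<^sub>2 "laplacian2 c"
  proof
    show "projection_valued_measure P\<^sub>2" using assms(4) by (simp add: spectral_measure_of_def)
    show "subspace (laplacian2 c)"
      unfolding laplacian2_eq_closure by (intro subspace_closure subspace_laplacian_core)
  qed fact
  let ?R = "wired_resistance c a x y"
  let ?\<xi> = "delta2 x - delta2 y :: 'a ell2"
  let ?I = "\<integral>\<^sup>+ t\<in>{0..}. (1 / ennreal t) \<partial>\<mu> ?\<xi>"
  have "?I \<le> ennreal ?R"
    by (rule inverse_moment_le_of_dirichlet_bound) (rule dirichlet_le_wired_resistance)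
  moreover have "ennreal ?R \<le> ?I"
  proof (rule ennreal_le_epsilon)
    fix e :: real assume e: "0 < e"
    obtain g w where gw: "(g, w) \<in> laplacian2 c" "?R - e < 2 * inner ?\<xi> g - inner w g"
      using dirichlet_approx_wired_resistance[OF e, of a x y] by auto
    have "ennreal ?R \<le> ennreal ((2 * inner ?\<xi> g - inner w g) + e)"
      using gw(2) by (intro ennreal_leI) simp
    also have "\<dots> \<le> ennreal (2 * inner ?\<xi> g - inner w g) + ennreal e"
      by (cases "0 \<le> 2 * inner ?\<xi> g - inner w g") (use e in \<open>auto simp: ennreal_neg intro!: ennreal_leI\<close>)
    also have "\<dots> \<le> ?I + ennreal e"
      using dirichlet_le_inverse_moment[OF inner_laplacian2_nonneg gw(1)] by (intro add_mono) auto
    finally show "ennreal ?R \<le> ?I + ennreal e" .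
  qed
  ultimately show ?thesis by (rule antisym[rotated])
qed

end
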